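(* Let $\psi:S^1\to\mathbb{R}$ be a $C^2$ function whose critical set $C'_\psi=\{\hat x\in S^1:\psi'(\hat x)=0\}$ is finite, with $\psi''(\hat x)\ne0$ for every $\hat x\in C'_\psi$, and with $\|\psi'\|_{C^0},\|\psi''\|_{C^0}\le 1/10$. There is $L_0>0$ depending only on $\psi$ such that for all $L\ge L_0$ the following holds. Let $k\in\mathbb{N}$ be arbitrary and let $a\in[0,1)$ be such that $f=f_{L,a}=L\psi+a\ (\mathrm{mod}\ 1)$ has the property that $f^{k+1}\hat x=\hat x$ for some $\hat x\in C'_\psi$. Then for any $0<\epsilon\le\frac1{49}L^{-(2k+1)}$, the random composition $f^n_{\underline\omega}$ admits a stationary measure $\mu$ for which (a) the support of $\mu$ is contained in a $\frac17L^{-(k+1)}$-neighborhood of the orbit $\hat x,f\hat x,\dots,f^k\hat x$ (in particular, $\operatorname{Supp}\mu\subsetneq S^1$); and (b) $\lambda_1(\mu)<0$.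
   Context: $S^1=\mathbb{R}/\mathbb{Z}$, parametrized by $[0,1)$, with the metric $d(x,y)=\min\{|x-y|,|x-y\pm1|\}$. Given $\epsilon>0$, let $\nu^\epsilon$ be the uniform distribution on $[-\epsilon,\epsilon]$, $\Omega=[-\epsilon,\epsilon]^{\mathbb{Z}_{\ge0}}$ with elements $\underline\omega=(\omega_0,\omega_1,\dots)$, and $\mathbb{P}=(\nu^\epsilon)^{\otimes\mathbb{Z}_{\ge0}}$. For $\omega\in[-\epsilon,\epsilon]$ put $f_\omega(x)=f(x+\omega)$ (argument taken mod 1), and $f^n_{\underline\omega}=f_{\omega_{n-1}}\circ\cdots\circ f_{\omega_0}$. A Borel probability measure $\mu$ on $S^1$ is stationary if $\mu(B)=\int_{S^1}\nu^\epsilon\{\omega:f_\omega(x)\in B\}\,d\mu(x)$ for all Borel $B\subset S^1$. The Lyapunov exponent $\lambda_1(\mu)$ of such a measure is the constant value of $\lim_{n\to\infty}\frac1n\log|(f^n_{\underline\omega})'(x)|$ for $\mu$-a.e. $x\in S^1$ and $\mathbb{P}$-a.e. $\underline\omega\in\Omega$. *)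

theory Defs
  imports "HOL-Probability.Probability"
begin

text \<open>
  The circle \<open>\<real>/\<int>\<close> is represented by its parametrization \<open>[0,1)\<close>, reduction mod 1 being
  \<^const>\<open>frac\<close>.  Real functions on the circle are 1-periodic functions on the real line.
\<close>

definition circle :: "real set" where
  "circle = {0..<1}"

definition circle_dist :: "real \<Rightarrow> real \<Rightarrow> real" where
  "circle_dist x y = min \<bar>x - y\<bar> (min \<bar>x - y + 1\<bar> \<bar>x - y - 1\<bar>)"

text \<open>
  The Borel sets of the circle metric and of the usual metric on \<open>[0,1)\<close> coincide.  The supports
  of measures do not, so \<open>circle_support\<close> below uses the circle metric.
\<close>

definition circle_borel :: "real measure" where
  "circle_borel = restrict_space borel circle"

definition circle_C2 :: "(real \<Rightarrow> real) \<Rightarrow> bool" where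
  "circle_C2 \<psi> \<longleftrightarrow>
     (\<forall>x. \<psi> (x + 1) = \<psi> x) \<and>
     (\<forall>x. \<psi> differentiable (at x)) \<and>
     (\<forall>x. deriv \<psi> differentiable (at x)) \<and>
     continuous_on UNIV (deriv (deriv \<psi>))"

definition C0_norm :: "(real \<Rightarrow> real) \<Rightarrow> real" where
  "C0_norm g = (SUP x\<in>circle. \<bar>g x\<bar>)"

definition critical_set :: "(real \<Rightarrow> real) \<Rightarrow> real set" where
  "critical_set \<psi> = {x \<in> circle. deriv \<psi> x = 0}"

definition circle_map :: "(real \<Rightarrow> real) \<Rightarrow> real \<Rightarrow> real \<Rightarrow> real \<Rightarrow> real" where
  "circle_map \<psi> L a x = frac (L * \<psi> x + a)"

text \<open>
  The derivative of a circle map \<open>g\<close> at \<open>x\<close>, computed in the chart around \<open>g x\<close> that sends a point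
  \<open>y\<close> to the representative in \<open>[-1/2,1/2)\<close> of \<open>y - g x\<close> mod 1.
\<close>

definition circle_deriv :: "(real \<Rightarrow> real) \<Rightarrow> real \<Rightarrow> real" where
  "circle_deriv g x =
     deriv (\<lambda>h. let t = g (frac (x + h)) - g x in t - of_int (round t)) 0"

definition perturbed_map :: "(real \<Rightarrow> real) \<Rightarrow> real \<Rightarrow> real \<Rightarrow> real" where
  "perturbed_map f w x = f (frac (x + w))"

primrec random_comp :: "(real \<Rightarrow> real) \<Rightarrow> (nat \<Rightarrow> real) \<Rightarrow> nat \<Rightarrow> real \<Rightarrow> real" where
  "random_comp f \<omega> 0 = (\<lambda>x. x)"
| "random_comp f \<omega> (Suc n) = perturbed_map f (\<omega> n) \<circ> random_comp f \<omega> n"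

text \<open>
  The noise distribution is regarded as a measure on the whole real line, concentrated on
  \<open>[-\<epsilon>,\<epsilon>]\<close>; accordingly its power is a measure on all real sequences.
\<close>

definition noise :: "real \<Rightarrow> real measure" where
  "noise \<epsilon> = uniform_measure lborel {-\<epsilon>..\<epsilon>}"

definition noise_seq :: "real \<Rightarrow> (nat \<Rightarrow> real) measure" where
  "noise_seq \<epsilon> = (\<Pi>\<^sub>M i\<in>UNIV. noise \<epsilon>)"

definition stationary :: "(real \<Rightarrow> real) \<Rightarrow> real \<Rightarrow> real measure \<Rightarrow> bool" where
  "stationary f \<epsilon> \<mu> \<longleftrightarrow>
     prob_space \<mu> \<and> sets \<mu> = sets circle_borel \<and>
     (\<forall>B\<in>sets circle_borel.
        emeasure \<mu> B =
          (\<integral>\<^sup>+ x. emeasure (noise \<epsilon>) {w \<in> {-\<epsilon>..\<epsilon>}. perturbed_map f w x \<in> B} \<partial>\<mu>))"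

definition circle_support :: "real measure \<Rightarrow> real set" where
  "circle_support \<mu> =
     {x \<in> circle. \<forall>r>0. emeasure \<mu> {y \<in> circle. circle_dist x y < r} > 0}"

definition log_abs :: "real \<Rightarrow> ereal" where
  "log_abs t = (if t = 0 then -\<infinity> else ereal (ln \<bar>t\<bar>))"

definition has_lyapunov_exponent ::
    "(real \<Rightarrow> real) \<Rightarrow> real \<Rightarrow> real measure \<Rightarrow> real \<Rightarrow> bool" where
  "has_lyapunov_exponent f \<epsilon> \<mu> l \<longleftrightarrow>
     (AE x in \<mu>. AE \<omega> in noise_seq \<epsilon>.
        (\<lambda>n. log_abs (circle_deriv (random_comp f \<omega> n) x) / ereal (real n)) \<longlonglongrightarrow> ereal l)"

end

theory Submission
  imports Defs
begin

text \<open>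
  Lift the circle map to \<open>F y = L * \<psi> y + a\<close> on the real line.  Because \<open>F\<close> is 1-periodic, reduction
  mod 1 commutes with everything: the random orbit on the circle is \<^const>\<open>frac\<close> of the orbit of the
  chain \<open>X (n+1) = F (X n + \<omega> n)\<close>, and the derivative of the random composition is the ordinary
  derivative of the lifted composition.  The iterates of the critical point under \<open>F\<close> form, from
  the first iterate on, a genuine periodic orbit \<open>p\<close> of period \<open>k + 1\<close> on the line, whose last point is
  an integer translate of the critical point.

  Put an interval of radius \<open>r j = 1/49 * L ^ (j - 2k - 1)\<close> around the \<open>j\<close>-th point of the cycle,
  \<open>0 \<le> j \<le> k\<close>.  All radii are at least \<open>\<epsilon>\<close> and at most \<open>1/49 * L ^ (-(k+1))\<close>.  In one step distances grow by at
  most \<open>L / 10\<close>, while the radii grow by \<open>L\<close>; on the last interval the slope is at most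
  \<open>L / 10 * 2 r k\<close>, because the cycle passes through a zero of \<open>\<psi>'\<close> there, and this is
  small enough to return to the smallest radius.  So, measured in units of the radii, every noisy step
  contracts by the factor \<open>1/10\<close>, for every value of the noise, and the union of the intervals is
  forward invariant (lemma \<open>critical_cycle_contracts\<close> and locale \<open>contracting_cycle\<close>).

  Uniform contraction makes the noise forget the past: iterating from time \<open>-n\<close> to time \<open>0\<close> converges as
  \<open>n\<close> grows, and the law of the limit, averaged over the phase of the cycle, is a stationary measure
  carried by the intervals (lemma \<open>cycle_law_stationary\<close>).  Projecting it to the circle gives the
  measure of the theorem; the arcs are too short to cover the circle.

  The exponent is the Birkhoff average of \<open>g (X n + \<omega> n)\<close> with \<open>g = ln \<bar>F'\<bar>\<close>.  It is obtained for every
  starting point in the intervals, not only almost every one, by a martingale argument in place of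
  the ergodic theorem.  Nondegeneracy of the critical points makes \<open>\<bar>F'\<bar> powr (-1/2)\<close> locally integrable,
  so \<open>g (x + \<cdot>)\<close> has an exponential moment under the noise and a strong law holds for the martingale
  differences \<open>g (X n + \<omega> n) - G (X n)\<close>, where \<open>G x\<close> is the mean of \<open>g (x + \<cdot>)\<close>
  (lemma \<open>martingale_strong_law\<close>).  By the same law \<open>G\<close> may be replaced by any of
  its images under the iterated Markov operator, and averages of \<open>k + 1\<close> consecutive late images are
  nearly constant because the chain contracts.  Hence the Birkhoff averages converge to a constant
  (lemma \<open>birkhoff_average_constant\<close>).  Finally the product of the slopes along \<open>n\<close> steps is at most a constant
  times \<open>(1/10) ^ n\<close>, so the constant is at most \<open>ln (1/10) < 0\<close>.
\<close>

section \<open>Orbits driven by independent noise\<close>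

primrec noisy_orbit :: "(real \<Rightarrow> real) \<Rightarrow> (nat \<Rightarrow> real) \<Rightarrow> nat \<Rightarrow> real \<Rightarrow> real" where
  "noisy_orbit F \<omega> 0 x = x"
| "noisy_orbit F \<omega> (Suc n) x = F (noisy_orbit F \<omega> n x + \<omega> n)"

lemma noisy_orbit_shift:
  "noisy_orbit F \<omega> (Suc n) x = noisy_orbit F (\<lambda>i. \<omega> (Suc i)) n (F (x + \<omega> 0))"
  by (induction n) simp_all

lemma noise_basics:
  assumes "0 < \<epsilon>"
  shows prob_space_noise: "prob_space (noise \<epsilon>)"
    and AE_noise: "AE w in noise \<epsilon>. w \<in> {-\<epsilon>..\<epsilon>}"
proof -
  have e: "emeasure lborel {-\<epsilon>..\<epsilon>} = ennreal (2 * \<epsilon>)" using assms by simp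
  show "prob_space (noise \<epsilon>)" unfolding noise_def
    by (rule prob_space_uniform_measure) (use e assms in auto)
  show "AE w in noise \<epsilon>. w \<in> {-\<epsilon>..\<epsilon>}" unfolding noise_def
    by (rule AE_uniform_measureI) auto
qed

lemma sets_noise [simp, measurable_cong]: "sets (noise \<epsilon>) = sets borel"
  by (simp add: noise_def)

lemma space_noise [simp]: "space (noise \<epsilon>) = UNIV"
  by (simp add: noise_def)

locale noisy_map =
  fixes F :: "real \<Rightarrow> real" and \<epsilon> :: real
  assumes F_measurable [measurable]: "F \<in> borel_measurable borel"
    and \<epsilon>_pos: "0 < \<epsilon>"
begin

sublocale N: prob_space "noise \<epsilon>"
  using prob_space_noise[OF \<epsilon>_pos] .

sublocale S: sequence_space "noise \<epsilon>"
  by unfold_locales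

lemma noise_seq_eq: "noise_seq \<epsilon> = S.S"
  by (simp add: noise_seq_def)

lemma prob_space_noise_seq: "prob_space (noise_seq \<epsilon>)"
  unfolding noise_seq_eq by unfold_locales

lemma sets_noise_seq [measurable_cong]: "sets (noise_seq \<epsilon>) = sets (PiM UNIV (\<lambda>_. borel))"
  unfolding noise_seq_eq by (intro sets_PiM_cong) auto

lemma space_noise_seq [simp]: "space (noise_seq \<epsilon>) = UNIV"
  by (simp add: noise_seq_eq space_PiM)

lemma noise_UNIV [simp]: "emeasure (noise \<epsilon>) UNIV = 1" "measure (noise \<epsilon>) UNIV = 1"
  using N.emeasure_space_1 N.prob_space by auto

abbreviation "orb \<equiv> noisy_orbit F"

lemma measurable_orbit [measurable (raw)]:
  assumes [measurable]: "f \<in> measurable M (PiM UNIV (\<lambda>_. borel))" "g \<in> borel_measurable M"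
  shows "(\<lambda>x. orb (f x) n (g x)) \<in> borel_measurable M"
  by (induction n) simp_all

lemma AE_noise_seq:
  "AE \<omega> in noise_seq \<epsilon>. \<forall>j. \<omega> j \<in> {-\<epsilon>..\<epsilon>}"
  unfolding noise_seq_eq AE_all_countable
  by (intro allI AE_PiM_component AE_noise \<epsilon>_pos prob_space_noise) auto

text \<open>
  Splitting off the first coordinate of the noise is the Markov property of the chain: together with
  \<open>noisy_orbit_shift\<close> it reduces a statement about \<open>Suc n\<close> steps from \<open>x\<close> to one about \<open>n\<close>
  steps from the random point \<open>F (x + w)\<close>.
\<close>

lemma noise_seq_shift:
  "distr (noise \<epsilon> \<Otimes>\<^sub>M noise_seq \<epsilon>) (noise_seq \<epsilon>) (\<lambda>(w, \<omega>). case_nat w \<omega>) = noise_seq \<epsilon>"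
  unfolding noise_seq_eq by (rule S.PiM_iter)

lemma measurable_case_nat_seq [measurable]:
  "(\<lambda>(w, \<omega>). case_nat w \<omega>) \<in> measurable (noise \<epsilon> \<Otimes>\<^sub>M noise_seq \<epsilon>) (noise_seq \<epsilon>)"
  unfolding noise_seq_eq by measurable

lemma nn_integral_noise_seq_shift:
  assumes [measurable]: "h \<in> borel_measurable (noise_seq \<epsilon>)"
  shows "(\<integral>\<^sup>+ \<omega>. h \<omega> \<partial>noise_seq \<epsilon>) = (\<integral>\<^sup>+ w. \<integral>\<^sup>+ \<omega>. h (case_nat w \<omega>) \<partial>noise_seq \<epsilon> \<partial>noise \<epsilon>)"
proof -
  interpret S': prob_space "noise_seq \<epsilon>" by (rule prob_space_noise_seq)
  have "(\<integral>\<^sup>+ \<omega>. h \<omega> \<partial>noise_seq \<epsilon>) = (\<integral>\<^sup>+ z. h (case z of (w, \<omega>) \<Rightarrow> case_nat w \<omega>) \<partial>(noise \<epsilon> \<Otimes>\<^sub>M noise_seq \<epsilon>))"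
    by (subst noise_seq_shift[symmetric], subst nn_integral_distr) auto
  also have "\<dots> = (\<integral>\<^sup>+ w. \<integral>\<^sup>+ \<omega>. h (case_nat w \<omega>) \<partial>noise_seq \<epsilon> \<partial>noise \<epsilon>)"
    by (subst S'.nn_integral_fst[symmetric]) auto
  finally show ?thesis .
qed

text \<open>
  Invariance is demanded for every admissible value of the noise rather than almost every one, which
  turns all later uses into deterministic statements about single orbits.
\<close>

definition invariant_set :: "real set \<Rightarrow> bool" where
  "invariant_set U \<longleftrightarrow> (\<forall>x\<in>U. \<forall>w\<in>{-\<epsilon>..\<epsilon>}. F (x + w) \<in> U)"

lemma orbit_in_invariant:
  assumes "invariant_set U" "x \<in> U" "\<forall>j. \<omega> j \<in> {-\<epsilon>..\<epsilon>}"
  shows "orb \<omega> n x \<in> U"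
  using assms by (induction n) (auto simp: invariant_set_def)

text \<open>
  Conditioning on the first step peels one factor off the product; the remaining factors have
  expectation at most \<open>q ^ n\<close> from wherever in \<open>U\<close> the first step lands.  With \<open>u\<close> an exponential this is
  the supermartingale bound behind the strong law; with \<open>u\<close> infinite on a set it shows that the set is avoided.
\<close>

lemma nn_integral_product_along_orbit:
  fixes u :: "real \<Rightarrow> real \<Rightarrow> ennreal"
  assumes [measurable]: "(\<lambda>(x, w). u x w) \<in> borel_measurable (borel \<Otimes>\<^sub>M borel)"
    and inv: "invariant_set U"
    and u: "\<And>x. x \<in> U \<Longrightarrow> (\<integral>\<^sup>+ w. u x w \<partial>noise \<epsilon>) \<le> q"
    and "x \<in> U"
  shows "(\<integral>\<^sup>+ \<omega>. (\<Prod>j<n. u (orb \<omega> j x) (\<omega> j)) \<partial>noise_seq \<epsilon>) \<le> q ^ n"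
  using \<open>x \<in> U\<close>
proof (induction n arbitrary: x)
  case 0
  then show ?case using prob_space.emeasure_space_1[OF prob_space_noise_seq] by simp
next
  case (Suc n)
  have "(\<integral>\<^sup>+ \<omega>. (\<Prod>j<Suc n. u (orb \<omega> j x) (\<omega> j)) \<partial>noise_seq \<epsilon>)
      = (\<integral>\<^sup>+ w. \<integral>\<^sup>+ \<omega>. (\<Prod>j<Suc n. u (orb (case_nat w \<omega>) j x) (case_nat w \<omega> j)) \<partial>noise_seq \<epsilon> \<partial>noise \<epsilon>)"
    by (rule nn_integral_noise_seq_shift) measurable
  also have "\<dots> = (\<integral>\<^sup>+ w. \<integral>\<^sup>+ \<omega>. u x w * (\<Prod>j<n. u (orb \<omega> j (F (x + w))) (\<omega> j)) \<partial>noise_seq \<epsilon> \<partial>noise \<epsilon>)"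
    by (simp add: prod.lessThan_Suc_shift noisy_orbit_shift del: prod.lessThan_Suc noisy_orbit.simps(2))
  also have "\<dots> = (\<integral>\<^sup>+ w. u x w * \<integral>\<^sup>+ \<omega>. (\<Prod>j<n. u (orb \<omega> j (F (x + w))) (\<omega> j)) \<partial>noise_seq \<epsilon> \<partial>noise \<epsilon>)"
    by (intro nn_integral_cong nn_integral_cmult) measurable
  also have "\<dots> \<le> (\<integral>\<^sup>+ w. u x w * q ^ n \<partial>noise \<epsilon>)"
  proof (rule nn_integral_mono_AE)
    show "AE w in noise \<epsilon>. u x w * \<integral>\<^sup>+ \<omega>. (\<Prod>j<n. u (orb \<omega> j (F (x + w))) (\<omega> j)) \<partial>noise_seq \<epsilon> \<le> u x w * q ^ n"
      using AE_noise[OF \<epsilon>_pos]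
    proof eventually_elim
      case (elim w)
      then have "F (x + w) \<in> U" using inv Suc.prems by (auto simp: invariant_set_def)
      from Suc.IH[OF this] show ?case by (rule mult_left_mono) simp
    qed
  qed
  also have "\<dots> = (\<integral>\<^sup>+ w. u x w \<partial>noise \<epsilon>) * q ^ n"
    by (rule nn_integral_multc) measurable
  also have "\<dots> \<le> q * q ^ n" by (intro mult_right_mono u Suc.prems) simp
  finally show ?case by simp
qed

end

section \<open>A strong law for martingale differences along noisy orbits\<close>

lemma exp_le_second_order:
  fixes y :: real
  shows "exp y \<le> 1 + y + y\<^sup>2 * exp \<bar>y\<bar>"
proof -
  obtain t where t: "\<bar>t\<bar> \<le> \<bar>y\<bar>" "exp y = (\<Sum>m<2. y ^ m / fact m) + exp t / fact 2 * y ^ 2"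
    using Maclaurin_exp_le[of y 2] by blast
  have "exp t \<le> exp \<bar>y\<bar>" using t(1) by simp
  moreover have "exp t / 2 \<le> exp t" by simp
  ultimately have "exp t / 2 * y\<^sup>2 \<le> exp \<bar>y\<bar> * y\<^sup>2"
    by (intro mult_right_mono) (auto intro: order_trans)
  then show ?thesis using t(2) by (simp add: numeral_2_eq_2 mult.commute)
qed

lemma square_le_exp:
  fixes z :: real
  assumes "0 \<le> z"
  shows "z\<^sup>2 \<le> 2 * exp z"
proof -
  have "1 + z + z\<^sup>2 / 2 \<le> exp z" by (rule exp_lower_Taylor_quadratic[OF assms])
  then show ?thesis using assms by (auto simp: field_simps)
qed

text \<open>
  Half of the available exponent \<open>s\<close> pays for the factor \<open>h\<^sup>2\<close> in the second-order expansion, the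
  other half for \<open>exp \<bar>t * h\<bar>\<close>.
\<close>

lemma exp_moment_le:
  fixes h s t :: real
  assumes "0 < s" "0 \<le> t" "t \<le> s / 2"
  shows "exp (t * h) \<le> 1 + t * h + t\<^sup>2 * (8 / s\<^sup>2) * exp (s * \<bar>h\<bar>)"
proof -
  have "(s / 2 * \<bar>h\<bar>)\<^sup>2 \<le> 2 * exp (s / 2 * \<bar>h\<bar>)"
    using assms by (intro square_le_exp) auto
  then have "h\<^sup>2 \<le> 8 / s\<^sup>2 * exp (s / 2 * \<bar>h\<bar>)"
    using assms by (simp add: power_mult_distrib power_divide field_simps)
  moreover have "exp \<bar>t * h\<bar> \<le> exp (s / 2 * \<bar>h\<bar>)"
    using mult_right_mono[OF assms(3), of "\<bar>h\<bar>"] assms(2) by (simp add: abs_mult)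
  ultimately have "h\<^sup>2 * exp \<bar>t * h\<bar> \<le> 8 / s\<^sup>2 * exp (s / 2 * \<bar>h\<bar>) * exp (s / 2 * \<bar>h\<bar>)"
    by (intro mult_mono) auto
  also have "\<dots> = 8 / s\<^sup>2 * exp (s * \<bar>h\<bar>)"
    by (simp flip: exp_add add: field_simps)
  finally have "t\<^sup>2 * (h\<^sup>2 * exp \<bar>t * h\<bar>) \<le> t\<^sup>2 * (8 / s\<^sup>2 * exp (s * \<bar>h\<bar>))"
    by (rule mult_left_mono) simp
  then show ?thesis using exp_le_second_order[of "t * h"]
    by (simp add: power_mult_distrib algebra_simps)
qed

lemma integrable_exp_moment:
  fixes h :: "'a \<Rightarrow> real"
  assumes [measurable]: "h \<in> borel_measurable M"
    and moment: "(\<integral>\<^sup>+ w. ennreal (exp (s * \<bar>h w\<bar>)) \<partial>M) \<le> ennreal C"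
  shows "integrable M (\<lambda>w. exp (s * \<bar>h w\<bar>))"
  using moment by (intro integrableI_bounded) (auto simp: less_top[symmetric] top_unique)

lemma integrable_of_exp_moment:
  fixes h :: "'a \<Rightarrow> real"
  assumes [measurable]: "h \<in> borel_measurable M" and s: "0 < s"
    and moment: "(\<integral>\<^sup>+ w. ennreal (exp (s * \<bar>h w\<bar>)) \<partial>M) \<le> ennreal C"
  shows "integrable M h"
proof (rule Bochner_Integration.integrable_bound[of _ "\<lambda>w. 1 / s * exp (s * \<bar>h w\<bar>)"])
  have "s * \<bar>h w\<bar> \<le> exp (s * \<bar>h w\<bar>)" for w
    using exp_ge_add_one_self[of "s * \<bar>h w\<bar>"] by linarith
  then show "AE w in M. norm (h w) \<le> norm (1 / s * exp (s * \<bar>h w\<bar>))"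
    using s by (auto simp: field_simps intro!: AE_I2)
qed (use integrable_exp_moment[OF assms(1) moment] in auto)

context noisy_map
begin

text \<open>
  A Chernoff bound with summable tails.  Since \<open>h\<close> has mean zero, \<open>exp (t * h)\<close> has mean at most
  \<open>exp (K * t\<^sup>2)\<close>, so for small \<open>t\<close> the weight \<open>exp (t * (h - \<delta>))\<close> has mean \<open>q < 1\<close> and its product along
  \<open>n\<close> steps has mean at most \<open>q ^ n\<close>.  The sum over \<open>n\<close> of these products is therefore finite
  almost surely, so eventually each product is below \<open>1\<close>, that is, the sum of \<open>h\<close> is below \<open>\<delta> * n\<close>.
\<close>

lemma martingale_upper_bound:
  fixes h :: "real \<Rightarrow> real \<Rightarrow> real"
  assumes h_meas [measurable]: "(\<lambda>(x, w). h x w) \<in> borel_measurable (borel \<Otimes>\<^sub>M borel)"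
    and inv: "invariant_set U" and "x \<in> U"
    and mean: "\<And>x. x \<in> U \<Longrightarrow> (LINT w|noise \<epsilon>. h x w) = 0"
    and s: "0 < s"
    and moment: "\<And>x. x \<in> U \<Longrightarrow> (\<integral>\<^sup>+ w. ennreal (exp (s * \<bar>h x w\<bar>)) \<partial>noise \<epsilon>) \<le> ennreal C"
    and \<delta>: "0 < \<delta>"
  shows "AE \<omega> in noise_seq \<epsilon>. \<forall>\<^sub>F n in sequentially. (\<Sum>j<n. h (orb \<omega> j x) (\<omega> j)) \<le> \<delta> * real n"
proof -
  define K where "K = 8 / s\<^sup>2 * \<bar>C\<bar>"
  define t where "t = min (s / 2) (\<delta> / (2 * K + 1))"
  define q where "q = exp (- (t * \<delta> / 2))"
  have K: "0 \<le> K" unfolding K_def by simp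
  have t: "0 < t" "t \<le> s / 2" and t_le: "t \<le> \<delta> / (2 * K + 1)"
    unfolding t_def by (use s \<delta> K in simp) (rule min.cobounded1, rule min.cobounded2)
  have t': "t * (2 * K + 1) \<le> \<delta>"
    using t_le K by (simp add: pos_le_divide_eq)
  have q: "0 < q" "q < 1" using t \<delta> by (auto simp: q_def)
  \<comment> \<open>\<open>K * t \<le> \<delta> / 2\<close> makes the linear term \<open>- t * \<delta>\<close> beat the quadratic one.\<close>
  define u where "u x w = ennreal (exp (t * (h x w - \<delta>)))" for x w
  have u_meas [measurable]: "(\<lambda>(x, w). u x w) \<in> borel_measurable (borel \<Otimes>\<^sub>M borel)"
    unfolding u_def by measurable
  have u_le: "(\<integral>\<^sup>+ w. u x w \<partial>noise \<epsilon>) \<le> ennreal q" if x: "x \<in> U" for x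
  proof -
    have [measurable]: "h x \<in> borel_measurable (noise \<epsilon>)" by measurable
    have int_e: "integrable (noise \<epsilon>) (\<lambda>w. exp (s * \<bar>h x w\<bar>))"
      by (rule integrable_exp_moment[OF _ moment[OF x]]) measurable
    have int_h: "integrable (noise \<epsilon>) (h x)"
      by (rule integrable_of_exp_moment[OF _ s moment[OF x]]) measurable
    have "exp (t * h x w) \<le> exp (s * \<bar>h x w\<bar>)" for w
    proof -
      have "t * h x w \<le> t * \<bar>h x w\<bar>" using t(1) by (intro mult_left_mono) auto
      also have "\<dots> \<le> s * \<bar>h x w\<bar>" using t s by (intro mult_right_mono) auto
      finally show ?thesis by simp
    qed
    then have int_t: "integrable (noise \<epsilon>) (\<lambda>w. exp (t * h x w))"
      by (intro Bochner_Integration.integrable_bound[OF int_e]) auto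
    have C: "(LINT w|noise \<epsilon>. exp (s * \<bar>h x w\<bar>)) \<le> \<bar>C\<bar>"
    proof -
      have "ennreal (LINT w|noise \<epsilon>. exp (s * \<bar>h x w\<bar>)) \<le> ennreal C"
        using moment[OF x] by (subst nn_integral_eq_integral[symmetric]) (use int_e in auto)
      also have "\<dots> \<le> ennreal \<bar>C\<bar>" by (rule ennreal_leI) simp
      finally show ?thesis by simp
    qed
    have "(LINT w|noise \<epsilon>. exp (t * h x w))
        \<le> (LINT w|noise \<epsilon>. 1 + t * h x w + t\<^sup>2 * (8 / s\<^sup>2) * exp (s * \<bar>h x w\<bar>))"
      using exp_moment_le[OF s _ t(2)] t(1) int_t int_h int_e
      by (intro integral_mono) auto
    also have "\<dots> = 1 + t\<^sup>2 * (8 / s\<^sup>2) * (LINT w|noise \<epsilon>. exp (s * \<bar>h x w\<bar>))"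
      using int_h int_e mean[OF x] by (simp add: N.prob_space)
    also have "\<dots> \<le> 1 + t\<^sup>2 * (8 / s\<^sup>2) * \<bar>C\<bar>"
      using C by (intro add_left_mono mult_left_mono) auto
    also have "\<dots> \<le> exp (t\<^sup>2 * K)"
      using exp_ge_add_one_self[of "t\<^sup>2 * K"] by (simp add: K_def mult.assoc)
    finally have 1: "(LINT w|noise \<epsilon>. exp (t * h x w)) \<le> exp (t\<^sup>2 * K)" .
    have "(\<integral>\<^sup>+ w. u x w \<partial>noise \<epsilon>) = (\<integral>\<^sup>+ w. ennreal (exp (t * h x w) * exp (- (t * \<delta>))) \<partial>noise \<epsilon>)"
      unfolding u_def by (simp flip: exp_add add: algebra_simps)
    also have "\<dots> = ennreal (LINT w|noise \<epsilon>. exp (t * h x w) * exp (- (t * \<delta>)))"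
      using int_t by (intro nn_integral_eq_integral) auto
    also have "\<dots> = ennreal ((LINT w|noise \<epsilon>. exp (t * h x w)) * exp (- (t * \<delta>)))"
      by simp
    also have "\<dots> \<le> ennreal (exp (t\<^sup>2 * K) * exp (- (t * \<delta>)))"
      using 1 by (intro ennreal_leI mult_right_mono) auto
    also have "\<dots> \<le> ennreal q"
    proof (rule ennreal_leI)
      have "t * (2 * t * K) \<le> t * \<delta>" using t t' by (intro mult_left_mono) (auto simp: algebra_simps)
      then show "exp (t\<^sup>2 * K) * exp (- (t * \<delta>)) \<le> q"
        by (simp add: q_def power2_eq_square flip: exp_add)
    qed
    finally show ?thesis .
  qed
  define a where "a \<omega> n = exp (t * ((\<Sum>j<n. h (orb \<omega> j x) (\<omega> j)) - \<delta> * real n))" for \<omega> n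
  have a_prod: "(\<Prod>j<n. u (orb \<omega> j x) (\<omega> j)) = ennreal (a \<omega> n)" for \<omega> n
    unfolding u_def a_def
    by (subst prod_ennreal)
      (auto simp: exp_sum[symmetric] sum_distrib_left[symmetric] sum_subtractf algebra_simps)
  have a_meas [measurable]: "(\<lambda>\<omega>. ennreal (a \<omega> n)) \<in> borel_measurable (noise_seq \<epsilon>)" for n
    unfolding a_prod[symmetric] by measurable
  have "(\<integral>\<^sup>+ \<omega>. (\<Sum>n. ennreal (a \<omega> n)) \<partial>noise_seq \<epsilon>) = (\<Sum>n. \<integral>\<^sup>+ \<omega>. ennreal (a \<omega> n) \<partial>noise_seq \<epsilon>)"
    by (rule nn_integral_suminf) measurable
  also have "\<dots> \<le> (\<Sum>n. ennreal (q ^ n))"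
  proof (intro suminf_le)
    show "(\<integral>\<^sup>+ \<omega>. ennreal (a \<omega> n) \<partial>noise_seq \<epsilon>) \<le> ennreal (q ^ n)" for n
      using nn_integral_product_along_orbit[OF u_meas inv u_le \<open>x \<in> U\<close>, of n] q
      by (simp add: a_prod ennreal_power)
  qed auto
  also have "\<dots> = ennreal (1 / (1 - q))"
    using q by (subst suminf_ennreal_eq[where x = "1 / (1 - q)"])
      (auto intro!: geometric_sums)
  finally have "(\<integral>\<^sup>+ \<omega>. (\<Sum>n. ennreal (a \<omega> n)) \<partial>noise_seq \<epsilon>) \<noteq> \<infinity>"
    by (auto simp: top_unique)
  then have "AE \<omega> in noise_seq \<epsilon>. (\<Sum>n. ennreal (a \<omega> n)) \<noteq> \<infinity>"
    by (intro nn_integral_PInf_AE) measurable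
  then show ?thesis
  proof eventually_elim
    case (elim \<omega>)
    have "summable (a \<omega>)"
      using elim by (intro summable_suminf_not_top) (auto simp: a_def)
    then have "a \<omega> \<longlonglongrightarrow> 0" by (rule summable_LIMSEQ_zero)
    then have "\<forall>\<^sub>F n in sequentially. a \<omega> n < 1" by (rule order_tendstoD) simp
    then show ?case
    proof eventually_elim
      case (elim n)
      then show ?case using t(1) by (auto simp: a_def mult_less_0_iff)
    qed
  qed
qed

lemma martingale_strong_law:
  fixes h :: "real \<Rightarrow> real \<Rightarrow> real"
  assumes h_meas [measurable]: "(\<lambda>(x, w). h x w) \<in> borel_measurable (borel \<Otimes>\<^sub>M borel)"
    and inv: "invariant_set U" and x: "x \<in> U"
    and mean: "\<And>x. x \<in> U \<Longrightarrow> (LINT w|noise \<epsilon>. h x w) = 0"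
    and s: "0 < s"
    and moment: "\<And>x. x \<in> U \<Longrightarrow> (\<integral>\<^sup>+ w. ennreal (exp (s * \<bar>h x w\<bar>)) \<partial>noise \<epsilon>) \<le> ennreal C"
  shows "AE \<omega> in noise_seq \<epsilon>. (\<lambda>n. (\<Sum>j<n. h (orb \<omega> j x) (\<omega> j)) / real n) \<longlonglongrightarrow> 0"
proof -
  have "AE \<omega> in noise_seq \<epsilon>. \<forall>m. \<forall>\<^sub>F n in sequentially.
      (\<Sum>j<n. h (orb \<omega> j x) (\<omega> j)) \<le> 1 / real (Suc m) * real n"
    unfolding AE_all_countable
    by (intro allI martingale_upper_bound[OF h_meas inv x mean s moment]) auto
  moreover have "AE \<omega> in noise_seq \<epsilon>. \<forall>m. \<forall>\<^sub>F n in sequentially.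
      (\<Sum>j<n. - h (orb \<omega> j x) (\<omega> j)) \<le> 1 / real (Suc m) * real n"
    unfolding AE_all_countable
    by (intro allI martingale_upper_bound[where h = "\<lambda>x w. - h x w", OF _ inv x _ s])
      (use mean moment in auto)
  ultimately show ?thesis
  proof eventually_elim
    case (elim \<omega>)
    show ?case
    proof (rule LIMSEQ_I)
      fix e :: real assume "0 < e"
      then obtain m where m: "1 / real (Suc m) < e" using nat_approx_posE by blast
      from elim(1)[rule_format, of m] elim(2)[rule_format, of m] eventually_gt_at_top[of 0]
      have "\<forall>\<^sub>F n in sequentially. norm ((\<Sum>j<n. h (orb \<omega> j x) (\<omega> j)) / real n - 0) < e"
      proof eventually_elim
        case (elim n)
        then have "\<bar>\<Sum>j<n. h (orb \<omega> j x) (\<omega> j)\<bar> \<le> 1 / real (Suc m) * real n"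
          by (simp add: sum_negf)
        also have "\<dots> < e * real n" using m elim by (intro mult_strict_right_mono) auto
        finally show ?case using elim by (simp add: field_simps)
      qed
      then show "\<exists>no. \<forall>n\<ge>no. norm ((\<Sum>j<n. h (orb \<omega> j x) (\<omega> j)) / real n - 0) < e"
        by (simp add: eventually_sequentially)
    qed
  qed
qed

end

section \<open>The Markov operator and Birkhoff averages\<close>

context noisy_map
begin

definition markov_op :: "(real \<Rightarrow> real) \<Rightarrow> real \<Rightarrow> real" where
  "markov_op \<phi> x = (LINT w|noise \<epsilon>. \<phi> (F (x + w)))"

lemma markov_op_measurable [measurable (raw)]:
  assumes [measurable]: "\<phi> \<in> borel_measurable borel"
    and [measurable]: "f \<in> borel_measurable M"
  shows "(\<lambda>x. markov_op \<phi> (f x)) \<in> borel_measurable M"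
  unfolding markov_op_def by measurable

lemma integrable_noise_bounded:
  fixes f :: "real \<Rightarrow> real"
  assumes [measurable]: "f \<in> borel_measurable borel"
    and "\<And>w. w \<in> {-\<epsilon>..\<epsilon>} \<Longrightarrow> \<bar>f w\<bar> \<le> B"
  shows "integrable (noise \<epsilon>) f"
  by (rule N.integrable_const_bound[of _ B])
    (use AE_noise[OF \<epsilon>_pos] assms(2) in \<open>auto elim: eventually_mono\<close>)

lemma integral_noise_near:
  fixes f :: "real \<Rightarrow> real"
  assumes [measurable]: "f \<in> borel_measurable borel"
    and near: "\<And>w. w \<in> {-\<epsilon>..\<epsilon>} \<Longrightarrow> \<bar>f w - c\<bar> \<le> \<eta>"
  shows "\<bar>(LINT w|noise \<epsilon>. f w) - c\<bar> \<le> \<eta>"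
proof -
  have int: "integrable (noise \<epsilon>) f"
    by (rule integrable_noise_bounded[of _ "\<bar>c\<bar> + \<eta>"]) (simp, use near in fastforce)
  have "(LINT w|noise \<epsilon>. f w) \<le> c + \<eta>"
    by (intro N.integral_le_const int eventually_mono[OF AE_noise[OF \<epsilon>_pos]]) (use near in fastforce)
  moreover have "(LINT w|noise \<epsilon>. f w) \<ge> c - \<eta>"
    by (intro N.integral_ge_const int eventually_mono[OF AE_noise[OF \<epsilon>_pos]]) (use near in fastforce)
  ultimately show ?thesis by simp
qed

lemma markov_op_bounded:
  assumes "\<phi> \<in> borel_measurable borel" "invariant_set U" "\<And>x. x \<in> U \<Longrightarrow> \<bar>\<phi> x\<bar> \<le> B" "x \<in> U"
  shows "\<bar>markov_op \<phi> x\<bar> \<le> B"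
  using integral_noise_near[of "\<lambda>w. \<phi> (F (x + w))" 0 B] assms
  unfolding markov_op_def by (auto simp: invariant_set_def)

lemma markov_op_funpow:
  assumes "\<phi> \<in> borel_measurable borel"
  shows "(markov_op ^^ i) \<phi> \<in> borel_measurable borel"
  by (induction i) (use assms markov_op_measurable[of _ "\<lambda>x. x"] in simp_all)

lemma markov_op_funpow_bounded:
  assumes "\<phi> \<in> borel_measurable borel" "invariant_set U" "\<And>x. x \<in> U \<Longrightarrow> \<bar>\<phi> x\<bar> \<le> B" "x \<in> U"
  shows "\<bar>(markov_op ^^ i) \<phi> x\<bar> \<le> B"
  using assms(4)
  by (induction i arbitrary: x)
    (auto intro!: assms(3) markov_op_bounded[OF markov_op_funpow[OF assms(1)] assms(2)])

text \<open>
  Up to the telescoping term \<open>\<phi> (X 0) - \<phi> (X n)\<close>, which is bounded, the sum of \<open>\<phi> - markov_op \<phi>\<close> along the orbit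
  is the sum of the martingale differences \<open>\<phi> (X (j+1)) - markov_op \<phi> (X j)\<close>.
\<close>

lemma markov_op_average:
  assumes \<phi> [measurable]: "\<phi> \<in> borel_measurable borel" and inv: "invariant_set U"
    and B: "\<And>x. x \<in> U \<Longrightarrow> \<bar>\<phi> x\<bar> \<le> B" and x: "x \<in> U"
  shows "AE \<omega> in noise_seq \<epsilon>.
    (\<lambda>n. (\<Sum>j<n. \<phi> (orb \<omega> j x) - markov_op \<phi> (orb \<omega> j x)) / real n) \<longlonglongrightarrow> 0"
proof -
  define h where "h x w = \<phi> (F (x + w)) - markov_op \<phi> x" for x w
  have PB: "\<bar>markov_op \<phi> x\<bar> \<le> B" if "x \<in> U" for x
    using markov_op_bounded[OF \<phi> inv B that] .
  have "AE \<omega> in noise_seq \<epsilon>. (\<lambda>n. (\<Sum>j<n. h (orb \<omega> j x) (\<omega> j)) / real n) \<longlonglongrightarrow> 0"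
  proof (rule martingale_strong_law[OF _ inv x])
    show "(\<lambda>(x, w). h x w) \<in> borel_measurable (borel \<Otimes>\<^sub>M borel)"
      unfolding h_def by measurable
    fix x assume x: "x \<in> U"
    have FU: "F (x + w) \<in> U" if "w \<in> {-\<epsilon>..\<epsilon>}" for w using inv x that by (auto simp: invariant_set_def)
    have "integrable (noise \<epsilon>) (\<lambda>w. \<phi> (F (x + w)))"
      by (rule integrable_noise_bounded[of _ B]) (use FU B in auto)
    then show "(LINT w|noise \<epsilon>. h x w) = 0"
      unfolding h_def by (simp add: markov_op_def N.prob_space)
    have "(\<integral>\<^sup>+ w. ennreal (exp (1 * \<bar>h x w\<bar>)) \<partial>noise \<epsilon>) \<le> (\<integral>\<^sup>+ w. ennreal (exp (2 * B)) \<partial>noise \<epsilon>)"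
    proof (rule nn_integral_mono_AE)
      show "AE w in noise \<epsilon>. ennreal (exp (1 * \<bar>h x w\<bar>)) \<le> ennreal (exp (2 * B))"
        using AE_noise[OF \<epsilon>_pos]
      proof eventually_elim
        case (elim w)
        then show ?case using PB[OF x] B[OF FU[OF elim]] by (auto simp: h_def intro!: ennreal_leI)
      qed
    qed
    also have "\<dots> = ennreal (exp (2 * B))"
      using N.emeasure_space_1 by simp
    finally show "(\<integral>\<^sup>+ w. ennreal (exp (1 * \<bar>h x w\<bar>)) \<partial>noise \<epsilon>) \<le> ennreal (exp (2 * B))" .
  qed simp
  then show ?thesis using AE_noise_seq
  proof eventually_elim
    case (elim \<omega>)
    have XU: "orb \<omega> n x \<in> U" for n by (rule orbit_in_invariant[OF inv x elim(2)])
    have "(\<lambda>n. (\<phi> x - \<phi> (orb \<omega> n x)) / real n) \<longlonglongrightarrow> 0"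
    proof (rule Lim_null_comparison)
      show "\<forall>\<^sub>F n in sequentially. norm ((\<phi> x - \<phi> (orb \<omega> n x)) / real n) \<le> (2 * B) / real n"
      proof (intro always_eventually allI)
        fix n show "norm ((\<phi> x - \<phi> (orb \<omega> n x)) / real n) \<le> (2 * B) / real n"
          using B[OF x] B[OF XU[of n]] by (auto simp: abs_div intro!: divide_right_mono)
      qed
      show "(\<lambda>n. 2 * B / real n) \<longlonglongrightarrow> 0" by real_asymp
    qed
    from tendsto_add[OF elim(1) this]
    have "(\<lambda>n. (\<Sum>j<n. h (orb \<omega> j x) (\<omega> j)) / real n + (\<phi> x - \<phi> (orb \<omega> n x)) / real n) \<longlonglongrightarrow> 0" by simp
    moreover have "(\<Sum>j<n. h (orb \<omega> j x) (\<omega> j)) + (\<phi> x - \<phi> (orb \<omega> n x))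
        = (\<Sum>j<n. \<phi> (orb \<omega> j x) - markov_op \<phi> (orb \<omega> j x))" for n
      by (induction n) (auto simp: h_def)
    ultimately show ?case by (simp flip: add_divide_distrib)
  qed
qed

text \<open>
  The differences between \<open>g (X j + \<omega> j)\<close> and its conditional mean \<open>G (X j)\<close> average out by the strong law,
  and so do the differences between consecutive images of \<open>G\<close> under the Markov operator.  In this
  way a Birkhoff average of \<open>g\<close> is traded for one of a much smoother function.
\<close>

lemma average_eq_markov_iterate:
  fixes g :: "real \<Rightarrow> real"
  assumes g [measurable]: "g \<in> borel_measurable borel" and inv: "invariant_set U" and x: "x \<in> U"
    and s: "0 < s"
    and moment: "\<And>x. x \<in> U \<Longrightarrow> (\<integral>\<^sup>+ w. ennreal (exp (s * \<bar>g (x + w)\<bar>)) \<partial>noise \<epsilon>) \<le> ennreal C"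
    and B: "\<And>x. x \<in> U \<Longrightarrow> \<bar>LINT w|noise \<epsilon>. g (x + w)\<bar> \<le> B"
  defines "G \<equiv> \<lambda>x. LINT w|noise \<epsilon>. g (x + w)"
  shows "AE \<omega> in noise_seq \<epsilon>. \<forall>i.
    (\<lambda>n. (\<Sum>j<n. g (orb \<omega> j x + \<omega> j) - (markov_op ^^ i) G (orb \<omega> j x)) / real n) \<longlonglongrightarrow> 0"
proof -
  have G [measurable]: "G \<in> borel_measurable borel" unfolding G_def by measurable
  have GB: "\<bar>G x\<bar> \<le> B" if "x \<in> U" for x using B[OF that] by (simp add: G_def)
  have "AE \<omega> in noise_seq \<epsilon>. (\<lambda>n. (\<Sum>j<n. g (orb \<omega> j x + \<omega> j) - G (orb \<omega> j x)) / real n) \<longlonglongrightarrow> 0"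
  proof (rule martingale_strong_law[where h = "\<lambda>x w. g (x + w) - G x", OF _ inv x _ s])
    fix x assume x: "x \<in> U"
    have "integrable (noise \<epsilon>) (\<lambda>w. g (x + w))"
      by (rule integrable_of_exp_moment[OF _ s moment[OF x]]) measurable
    then show "(LINT w|noise \<epsilon>. g (x + w) - G x) = 0"
      by (simp add: G_def N.prob_space)
    have "exp (s * \<bar>g (x + w) - G x\<bar>) \<le> exp (s * \<bar>g (x + w)\<bar>) * exp (s * B)" for w
    proof -
      have "s * \<bar>g (x + w) - G x\<bar> \<le> s * (\<bar>g (x + w)\<bar> + B)"
        using s GB[OF x] by (intro mult_left_mono) auto
      then show ?thesis by (simp flip: exp_add add: distrib_left)
    qed
    then have "(\<integral>\<^sup>+ w. ennreal (exp (s * \<bar>g (x + w) - G x\<bar>)) \<partial>noise \<epsilon>)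
        \<le> (\<integral>\<^sup>+ w. ennreal (exp (s * \<bar>g (x + w)\<bar>)) * ennreal (exp (s * B)) \<partial>noise \<epsilon>)"
      by (intro nn_integral_mono) (auto simp flip: ennreal_mult' intro!: ennreal_leI)
    also have "\<dots> = (\<integral>\<^sup>+ w. ennreal (exp (s * \<bar>g (x + w)\<bar>)) \<partial>noise \<epsilon>) * ennreal (exp (s * B))"
      by (rule nn_integral_multc) measurable
    also have "\<dots> \<le> ennreal C * ennreal (exp (s * B))"
      by (intro mult_right_mono moment x) auto
    also have "\<dots> = ennreal (C * exp (s * B))" by (simp add: ennreal_mult'')
    finally show "(\<integral>\<^sup>+ w. ennreal (exp (s * \<bar>g (x + w) - G x\<bar>)) \<partial>noise \<epsilon>) \<le> ennreal (C * exp (s * B))" .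
  qed measurable
  moreover have "AE \<omega> in noise_seq \<epsilon>. \<forall>i. (\<lambda>n. (\<Sum>j<n. (markov_op ^^ i) G (orb \<omega> j x)
      - (markov_op ^^ Suc i) G (orb \<omega> j x)) / real n) \<longlonglongrightarrow> 0"
    unfolding AE_all_countable
  proof
    fix i
    show "AE \<omega> in noise_seq \<epsilon>. (\<lambda>n. (\<Sum>j<n. (markov_op ^^ i) G (orb \<omega> j x)
      - (markov_op ^^ Suc i) G (orb \<omega> j x)) / real n) \<longlonglongrightarrow> 0"
      using markov_op_average[OF markov_op_funpow[OF G] inv markov_op_funpow_bounded[OF G inv GB] x]
      by simp
  qed
  ultimately show ?thesis
  proof eventually_elim
    case (elim \<omega>)
    show ?case
    proof
      fix i
      show "(\<lambda>n. (\<Sum>j<n. g (orb \<omega> j x + \<omega> j) - (markov_op ^^ i) G (orb \<omega> j x)) / real n) \<longlonglongrightarrow> 0"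
      proof (induction i)
        case 0
        then show ?case using elim(1) by simp
      next
        case (Suc i)
        from tendsto_add[OF this elim(2)[rule_format, of i]] show ?case
          by (simp add: sum.distrib[symmetric] add_divide_distrib[symmetric] del: funpow.simps)
      qed
    qed
  qed
qed

end

section \<open>Contracting cycles of intervals\<close>

text \<open>
  A cycle \<open>p\<close> of \<open>F\<close> with intervals of radii \<open>r\<close> around its points such that \<open>F\<close>, even after a noise
  of size \<open>\<epsilon>\<close>, contracts by \<open>\<theta>\<close> when distances near \<open>p i\<close> are measured in units of \<open>r i\<close>.  The radii
  play the role of an adapted metric: in the Euclidean metric single steps may expand.  Both
  sequences are indexed by all natural numbers and periodic, which avoids arithmetic modulo \<open>N\<close>.
\<close>

locale contracting_cycle =
  fixes F F' :: "real \<Rightarrow> real" and p r :: "nat \<Rightarrow> real" and N :: nat and \<epsilon> \<theta> :: real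
  assumes N_pos: "0 < N"
    and p_period: "p (i + N) = p i" and r_period: "r (i + N) = r i"
    and F_p: "F (p i) = p (Suc i)"
    and eps_pos: "0 < \<epsilon>" and eps_le: "\<epsilon> \<le> r i"
    and theta: "0 < \<theta>" "\<theta> \<le> 1 / 2"
    and F_deriv: "(F has_real_derivative F' x) (at x)"
    and F'_cont: "continuous_on UNIV F'"
    and contr: "\<bar>y - p i\<bar> \<le> r i + \<epsilon> \<Longrightarrow> \<bar>F' y\<bar> * r i \<le> \<theta> * r (Suc i)"
begin

lemma F_cont: "continuous_on UNIV F"
  using F_deriv by (auto intro: continuous_at_imp_continuous_on DERIV_isCont)

sublocale noisy_map F \<epsilon>
  by unfold_locales (use F_cont eps_pos in \<open>auto intro: borel_measurable_continuous_onI\<close>)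

lemma r_pos: "0 < r i"
  using eps_pos eps_le[of i] by simp

definition trap :: "nat \<Rightarrow> real set" where
  "trap i = {x. \<bar>x - p i\<bar> \<le> r i}"

definition trap_union :: "real set" where
  "trap_union = (\<Union>i. trap i)"

lemma trap_period: "trap (i + N) = trap i"
  by (simp add: trap_def p_period r_period)

lemma trap_add_mult: "trap (i + m * N) = trap i"
proof (induction m)
  case (Suc m)
  then show ?case using trap_period[of "i + m * N"] by (simp add: algebra_simps)
qed simp

lemma trap_union_eq: "trap_union = (\<Union>i<N. trap i)"
proof -
  have "trap i = trap (i mod N)" for i
    using trap_add_mult[of "i mod N" "i div N"] by simp
  then have "trap i \<subseteq> (\<Union>i<N. trap i)" for i
    using N_pos by (metis UN_upper lessThan_iff mod_less_divisor)
  then show ?thesis unfolding trap_union_def by blast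
qed

lemma r_bound: "\<exists>R>0. \<forall>i. r i \<le> R"
proof (intro exI conjI allI)
  have per: "r (i + m * N) = r i" for i m
  proof (induction m)
    case (Suc m)
    then show ?case using r_period[of "i + m * N"] by (simp add: algebra_simps)
  qed simp
  show "r i \<le> Max (r ` {..<N})" for i
    using per[of "i mod N" "i div N"] N_pos by (auto intro!: Max_ge)
  then show "0 < Max (r ` {..<N})" using r_pos[of 0] by (meson less_le_trans)
qed

lemma F_contracts:
  assumes "\<bar>x - p i\<bar> \<le> r i + \<epsilon>" "\<bar>y - p i\<bar> \<le> r i + \<epsilon>"
  shows "\<bar>F x - F y\<bar> * r i \<le> \<theta> * r (Suc i) * \<bar>x - y\<bar>"
proof -
  have *: "\<bar>F x - F y\<bar> * r i \<le> \<theta> * r (Suc i) * \<bar>x - y\<bar>"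
    if xy: "x < y" "\<bar>x - p i\<bar> \<le> r i + \<epsilon>" "\<bar>y - p i\<bar> \<le> r i + \<epsilon>" for x y
  proof -
    obtain z where z: "x < z" "z < y" "F y - F x = (y - x) * F' z"
      using MVT2[OF xy(1), of F F'] F_deriv by blast
    have "\<bar>F' z\<bar> * r i \<le> \<theta> * r (Suc i)" by (rule contr) (use z that in auto)
    then have "\<bar>F' z\<bar> * r i * (y - x) \<le> \<theta> * r (Suc i) * (y - x)"
      using that by (intro mult_right_mono) auto
    moreover have "\<bar>F x - F y\<bar> = \<bar>F' z\<bar> * (y - x)"
      using z that by (metis abs_minus_commute abs_mult abs_of_pos diff_gt_0_iff_gt mult.commute)
    moreover have "\<bar>x - y\<bar> = y - x" using xy by simp
    ultimately show ?thesis by (simp add: mult.commute mult.left_commute)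
  qed
  show ?thesis using *[of x y] *[of y x] assms
    by (cases x y rule: linorder_cases) (auto simp: abs_minus_commute)
qed

lemma F_contracts_trap:
  assumes "x \<in> trap i" "y \<in> trap i" "w \<in> {-\<epsilon>..\<epsilon>}"
  shows "\<bar>F (x + w) - F (y + w)\<bar> * r i \<le> \<theta> * r (Suc i) * \<bar>x - y\<bar>"
  using F_contracts[of "x + w" i "y + w"] assms by (auto simp: trap_def)

text \<open>
  A point of the \<open>i\<close>-th interval is moved by the noise to a distance of at most \<open>r i + \<epsilon> \<le> 2 * r i\<close> from \<open>p i\<close>;
  the bound \<open>\<theta> \<le> 1 / 2\<close> compensates the factor \<open>2\<close>.
\<close>

lemma F_trap:
  assumes "x \<in> trap i" "w \<in> {-\<epsilon>..\<epsilon>}"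
  shows "F (x + w) \<in> trap (Suc i)"
proof -
  have "\<bar>x + w - p i\<bar> \<le> 2 * r i" using assms eps_le[of i] by (auto simp: trap_def)
  then have "\<theta> * r (Suc i) * \<bar>x + w - p i\<bar> \<le> (\<theta> * r (Suc i)) * (2 * r i)"
    using theta r_pos[of "Suc i"] by (intro mult_left_mono) auto
  also have "\<dots> = (2 * \<theta>) * (r (Suc i) * r i)" by simp
  also have "\<dots> \<le> 1 * (r (Suc i) * r i)"
    using theta r_pos[of i] r_pos[of "Suc i"] by (intro mult_right_mono) auto
  finally have "\<theta> * r (Suc i) * \<bar>x + w - p i\<bar> \<le> r (Suc i) * r i" by simp
  moreover have "\<bar>F (x + w) - F (p i)\<bar> * r i \<le> \<theta> * r (Suc i) * \<bar>x + w - p i\<bar>"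
    by (rule F_contracts) (use assms r_pos[of i] eps_pos in \<open>auto simp: trap_def\<close>)
  ultimately have "\<bar>F (x + w) - F (p i)\<bar> * r i \<le> r (Suc i) * r i" by simp
  then show ?thesis using r_pos[of i] by (simp add: trap_def F_p)
qed

lemma invariant_trap_union: "invariant_set trap_union"
  unfolding invariant_set_def trap_union_def using F_trap by blast

text \<open>
  One application of the Markov operator improves a modulus of continuity by \<open>\<theta>\<close>, since both points
  are moved by the same noise and come closer.
\<close>

lemma markov_op_modulus:
  assumes [measurable]: "\<phi> \<in> borel_measurable borel"
    and B: "\<And>x. x \<in> trap_union \<Longrightarrow> \<bar>\<phi> x\<bar> \<le> B"
    and mod: "\<And>i x y. x \<in> trap i \<Longrightarrow> y \<in> trap i \<Longrightarrow> \<bar>x - y\<bar> \<le> s * r i \<Longrightarrow> \<bar>\<phi> x - \<phi> y\<bar> \<le> \<eta>"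
    and xy: "x \<in> trap i" "y \<in> trap i" "\<bar>x - y\<bar> \<le> s / \<theta> * r i"
  shows "\<bar>markov_op \<phi> x - markov_op \<phi> y\<bar> \<le> \<eta>"
proof -
  have Ft: "F (x + w) \<in> trap (Suc i)" "F (y + w) \<in> trap (Suc i)" if "w \<in> {-\<epsilon>..\<epsilon>}" for w
    using F_trap xy that by auto
  have int: "integrable (noise \<epsilon>) (\<lambda>w. \<phi> (F (x + w)))" "integrable (noise \<epsilon>) (\<lambda>w. \<phi> (F (y + w)))"
    using Ft by (auto intro!: integrable_noise_bounded[of _ B] B simp: trap_union_def) blast+
  have "\<bar>(LINT w|noise \<epsilon>. \<phi> (F (x + w)) - \<phi> (F (y + w))) - 0\<bar> \<le> \<eta>"
  proof (rule integral_noise_near)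
    fix w assume w: "w \<in> {-\<epsilon>..\<epsilon>}"
    have "\<bar>F (x + w) - F (y + w)\<bar> * r i \<le> \<theta> * r (Suc i) * \<bar>x - y\<bar>"
      by (rule F_contracts_trap[OF xy(1,2) w])
    also have "\<dots> \<le> \<theta> * r (Suc i) * (s / \<theta> * r i)"
      using xy(3) theta r_pos[of "Suc i"] by (intro mult_left_mono) auto
    also have "\<dots> = (s * r (Suc i)) * r i" using theta by simp
    finally have "\<bar>F (x + w) - F (y + w)\<bar> \<le> s * r (Suc i)" using r_pos[of i] by simp
    then show "\<bar>\<phi> (F (x + w)) - \<phi> (F (y + w)) - 0\<bar> \<le> \<eta>" using mod[OF Ft[OF w]] by simp
  qed measurable
  then show ?thesis using int by (simp add: markov_op_def)
qed

text \<open>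
  After \<open>m\<close> applications of the Markov operator a uniformly continuous \<open>G\<close> is nearly constant on each
  single interval.  From then on the operator merely shifts these \<open>N\<close> values along the cycle, so the
  mean over one full period no longer depends on the interval.
\<close>

lemma markov_averages_near_constant:
  assumes G: "G \<in> borel_measurable borel"
    and B: "\<And>x. x \<in> trap_union \<Longrightarrow> \<bar>G x\<bar> \<le> B"
    and uc: "uniformly_continuous_on trap_union G" and \<eta>: "0 < \<eta>"
  shows "\<exists>m c. \<forall>x\<in>trap_union. \<bar>(\<Sum>j<N. (markov_op ^^ (m + j)) G x) / real N - c\<bar> \<le> \<eta>"
proof -
  obtain d where d: "0 < d" "\<And>x y. x \<in> trap_union \<Longrightarrow> y \<in> trap_union \<Longrightarrow> \<bar>x - y\<bar> < d \<Longrightarrow> \<bar>G x - G y\<bar> < \<eta>"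
    using uc \<eta> unfolding uniformly_continuous_on_def dist_real_def by (metis abs_minus_commute)
  obtain R where R: "0 < R" "\<And>i. r i \<le> R" using r_bound by blast
  define s where "s = d / (2 * R)"
  have s: "0 < s" using d R by (simp add: s_def)
  have sr: "s * r i < d" for i
  proof -
    have "s * r i \<le> s * R" using s R by (intro mult_left_mono) auto
    also have "\<dots> < d" using d R by (simp add: s_def)
    finally show ?thesis .
  qed
  have mod: "\<bar>(markov_op ^^ m) G x - (markov_op ^^ m) G y\<bar> \<le> \<eta>"
    if "x \<in> trap i" "y \<in> trap i" "\<bar>x - y\<bar> \<le> s / \<theta> ^ m * r i" for m i x y
    using that
  proof (induction m arbitrary: i x y)
    case 0
    then show ?case using d(2)[of x y] sr[of i] by (fastforce simp: trap_union_def)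
  next
    case (Suc m)
    have "\<bar>markov_op ((markov_op ^^ m) G) x - markov_op ((markov_op ^^ m) G) y\<bar> \<le> \<eta>"
      by (rule markov_op_modulus[of _ B "s / \<theta> ^ m" _ _ i])
        (use Suc G B invariant_trap_union theta in
          \<open>auto intro!: markov_op_funpow markov_op_funpow_bounded simp: field_simps\<close>)
    then show ?case by simp
  qed
  obtain m where m: "\<theta> ^ m < s / 2"
    using real_arch_pow_inv[of "s / 2" \<theta>] s theta by auto
  have m2: "2 \<le> s / \<theta> ^ m" using m theta by (simp add: field_simps)
  define \<phi> where "\<phi> = (markov_op ^^ m) G"
  have \<phi>_meas: "(markov_op ^^ j) \<phi> \<in> borel_measurable borel" for j
    unfolding \<phi>_def by (intro markov_op_funpow G)
  \<comment> \<open>The modulus \<open>s / \<theta> ^ m \<ge> 2\<close> covers the whole interval, whose length is \<open>2 * r i\<close>.\<close>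
  have osc: "\<bar>(markov_op ^^ j) \<phi> x - \<phi> (p (i + j))\<bar> \<le> \<eta>" if "x \<in> trap i" for x i j
    using that
  proof (induction j arbitrary: x i)
    case 0
    have "\<bar>x - p i\<bar> \<le> s / \<theta> ^ m * r i"
    proof -
      have "\<bar>x - p i\<bar> \<le> 2 * r i" using 0 r_pos[of i] by (auto simp: trap_def)
      also have "\<dots> \<le> s / \<theta> ^ m * r i" using m2 r_pos[of i] by (intro mult_right_mono) auto
      finally show ?thesis .
    qed
    moreover have "p i \<in> trap i" using r_pos[of i] by (simp add: trap_def)
    ultimately show ?case using mod[OF 0] by (simp add: \<phi>_def)
  next
    case (Suc j)
    have "\<bar>(LINT w|noise \<epsilon>. (markov_op ^^ j) \<phi> (F (x + w))) - \<phi> (p (Suc i + j))\<bar> \<le> \<eta>"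
    proof (intro integral_noise_near Suc.IH F_trap Suc.prems)
      note [measurable] = \<phi>_meas[of j]
      show "(\<lambda>w. (markov_op ^^ j) \<phi> (F (x + w))) \<in> borel_measurable borel" by measurable
    qed
    then show ?case by (simp add: markov_op_def[of "(markov_op ^^ j) \<phi>"])
  qed
  define c where "c = (\<Sum>j<N. \<phi> (p j)) / real N"
  have cyc: "(\<Sum>j<N. \<phi> (p (i + j))) = (\<Sum>j<N. \<phi> (p j))" for i
  proof (induction i)
    case (Suc i)
    have "(\<Sum>j<N. \<phi> (p (Suc i + j))) + \<phi> (p i) = (\<Sum>j<N. \<phi> (p (i + j))) + \<phi> (p (i + N))"
      using sum.lessThan_Suc_shift[of "\<lambda>j. \<phi> (p (i + j))" N] by simp
    then show ?case using Suc by (simp add: p_period)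
  qed simp
  have "\<bar>(\<Sum>j<N. (markov_op ^^ (m + j)) G x) / real N - c\<bar> \<le> \<eta>" if "x \<in> trap i" for x i
  proof -
    have "\<bar>(\<Sum>j<N. (markov_op ^^ j) \<phi> x) - (\<Sum>j<N. \<phi> (p (i + j)))\<bar> \<le> (\<Sum>j<N. \<eta>)"
      unfolding sum_subtractf[symmetric]
      by (rule order_trans[OF sum_abs]) (intro sum_mono osc that)
    then have "\<bar>(\<Sum>j<N. (markov_op ^^ j) \<phi> x) - (\<Sum>j<N. \<phi> (p j))\<bar> / real N \<le> \<eta>"
      using N_pos by (simp add: cyc pos_divide_le_eq mult.commute)
    moreover have "(markov_op ^^ j) \<phi> = (markov_op ^^ (m + j)) G" for j
      unfolding \<phi>_def by (metis add.commute comp_apply funpow_add)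
    ultimately show ?thesis by (simp add: c_def flip: diff_divide_distrib)
  qed
  then show ?thesis unfolding trap_union_def by blast
qed

text \<open>
  For each precision \<open>1 / Suc q\<close> the Birkhoff averages eventually stay close to the constant \<open>c q\<close> furnished by
  \<open>markov_averages_near_constant\<close>, which depends neither on the starting point nor on the noise.
  These constants form a Cauchy sequence, because one common orbit is close to all of them, and their
  limit is the limit of the averages.
\<close>

lemma birkhoff_average_constant:
  fixes g :: "real \<Rightarrow> real"
  assumes g: "g \<in> borel_measurable borel" and s: "0 < s"
    and moment: "\<And>x. x \<in> trap_union \<Longrightarrow> (\<integral>\<^sup>+ w. ennreal (exp (s * \<bar>g (x + w)\<bar>)) \<partial>noise \<epsilon>) \<le> ennreal C"
    and B: "\<And>x. x \<in> trap_union \<Longrightarrow> \<bar>LINT w|noise \<epsilon>. g (x + w)\<bar> \<le> B"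
    and uc: "uniformly_continuous_on trap_union (\<lambda>x. LINT w|noise \<epsilon>. g (x + w))"
  shows "\<exists>l. \<forall>x\<in>trap_union. AE \<omega> in noise_seq \<epsilon>.
           (\<lambda>n. (\<Sum>j<n. g (orb \<omega> j x + \<omega> j)) / real n) \<longlonglongrightarrow> l"
proof -
  define G where "G x = (LINT w|noise \<epsilon>. g (x + w))" for x
  have G_meas: "G \<in> borel_measurable borel" unfolding G_def using g by measurable
  have "\<forall>q. \<exists>m c. \<forall>x\<in>trap_union. \<bar>(\<Sum>j<N. (markov_op ^^ (m + j)) G x) / real N - c\<bar> \<le> 1 / real (Suc q)"
    using B uc by (intro allI markov_averages_near_constant[of G B] G_meas) (auto simp: G_def[abs_def])
  then obtain m c where mc: "\<forall>q. \<forall>x\<in>trap_union.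
      \<bar>(\<Sum>j<N. (markov_op ^^ (m q + j)) G x) / real N - c q\<bar> \<le> 1 / real (Suc q)"
    unfolding choice_iff by blast
  define A where "A \<omega> x n = (\<Sum>j<n. g (orb \<omega> j x + \<omega> j)) / real n" for \<omega> x n
  have close: "AE \<omega> in noise_seq \<epsilon>. \<forall>q. \<forall>\<^sub>F n in sequentially. \<bar>A \<omega> x n - c q\<bar> \<le> 2 / real (Suc q)"
    if x: "x \<in> trap_union" for x
  proof -
    have avg: "AE \<omega> in noise_seq \<epsilon>. \<forall>i. (\<lambda>n. (\<Sum>j<n. g (orb \<omega> j x + \<omega> j)
        - (markov_op ^^ i) G (orb \<omega> j x)) / real n) \<longlonglongrightarrow> 0"
      unfolding G_def[abs_def]
      by (rule average_eq_markov_iterate[OF g invariant_trap_union x s, of C B]) (use moment B in auto)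
    show ?thesis
      using avg AE_noise_seq
      proof eventually_elim
        case (elim \<omega>)
        show ?case
        proof
          fix q
          define D where "D i n = (\<Sum>j<n. g (orb \<omega> j x + \<omega> j) - (markov_op ^^ i) G (orb \<omega> j x)) / real n" for i n
          have D: "D i \<longlonglongrightarrow> 0" for i
            using elim(1) unfolding D_def by blast
          have "(\<lambda>n. (\<Sum>j<N. D (m q + j) n) / real N) \<longlonglongrightarrow> (\<Sum>j<N. 0) / real N"
            using N_pos by (intro tendsto_intros D) auto
          then have "(\<lambda>n. (\<Sum>j<N. D (m q + j) n) / real N) \<longlonglongrightarrow> 0" by simp
          then have "\<forall>\<^sub>F n in sequentially. \<bar>(\<Sum>j<N. D (m q + j) n) / real N\<bar> < 1 / real (Suc q)"
            by (auto dest!: tendstoD[where e = "1 / real (Suc q)"])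
          then show "\<forall>\<^sub>F n in sequentially. \<bar>A \<omega> x n - c q\<bar> \<le> 2 / real (Suc q)"
            using eventually_gt_at_top[of 0]
          proof eventually_elim
            case (elim n)
            define E where "E y = (\<Sum>j<N. (markov_op ^^ (m q + j)) G y) / real N" for y
            have "(\<Sum>j<N. D (m q + j) n) = (\<Sum>k<n. \<Sum>j<N. g (orb \<omega> k x + \<omega> k) - (markov_op ^^ (m q + j)) G (orb \<omega> k x)) / real n"
              unfolding D_def sum_divide_distrib[symmetric] by (subst sum.swap) (rule refl)
            also have "(\<Sum>k<n. \<Sum>j<N. g (orb \<omega> k x + \<omega> k) - (markov_op ^^ (m q + j)) G (orb \<omega> k x))
                = (\<Sum>k<n. real N * (g (orb \<omega> k x + \<omega> k) - E (orb \<omega> k x)))"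
              using N_pos by (intro sum.cong refl) (simp add: E_def sum_subtractf right_diff_distrib)
            also have "\<dots> = real N * (\<Sum>k<n. g (orb \<omega> k x + \<omega> k) - E (orb \<omega> k x))"
              by (rule sum_distrib_left[symmetric])
            finally have "(\<Sum>j<N. D (m q + j) n) / real N = (\<Sum>k<n. g (orb \<omega> k x + \<omega> k) - E (orb \<omega> k x)) / real n"
              using N_pos by simp
            also have "\<dots> = A \<omega> x n - (\<Sum>k<n. E (orb \<omega> k x)) / real n"
              by (simp add: A_def sum_subtractf diff_divide_distrib)
            finally have 1: "\<bar>A \<omega> x n - (\<Sum>k<n. E (orb \<omega> k x)) / real n\<bar> < 1 / real (Suc q)"
              using elim by simp
            have "\<bar>(\<Sum>k<n. E (orb \<omega> k x) - c q)\<bar> \<le> (\<Sum>k<n. 1 / real (Suc q))"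
              using orbit_in_invariant[OF invariant_trap_union x \<open>\<forall>j. \<omega> j \<in> {-\<epsilon>..\<epsilon>}\<close>] unfolding E_def
              by (intro order_trans[OF sum_abs] sum_mono mc[rule_format]) auto
            then have "\<bar>(\<Sum>k<n. E (orb \<omega> k x)) - real n * c q\<bar> / real n \<le> 1 / real (Suc q)"
              using elim by (simp add: sum_subtractf field_simps)
            also have "\<bar>(\<Sum>k<n. E (orb \<omega> k x)) - real n * c q\<bar> / real n = \<bar>(\<Sum>k<n. E (orb \<omega> k x)) / real n - c q\<bar>"
              using elim by (simp add: abs_if field_simps)
            finally show ?case using 1 by linarith
          qed
        qed
      qed
  qed
  have p0: "p 0 \<in> trap_union" using r_pos[of 0] unfolding trap_union_def by (intro UN_I[of 0]) (auto simp: trap_def)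
  have Cauchy_c: "\<bar>c q - c q'\<bar> \<le> 2 / real (Suc q) + 2 / real (Suc q')" for q q'
  proof -
    interpret S': prob_space "noise_seq \<epsilon>" by (rule prob_space_noise_seq)
    obtain \<omega> where \<omega>: "\<forall>q. \<forall>\<^sub>F n in sequentially. \<bar>A \<omega> (p 0) n - c q\<bar> \<le> 2 / real (Suc q)"
      using eventually_happens'[OF S'.ae_filter_bot close[OF p0]] by blast
    have "\<forall>\<^sub>F n in sequentially. \<bar>c q - c q'\<bar> \<le> 2 / real (Suc q) + 2 / real (Suc q')"
      using \<omega>[rule_format, of q] \<omega>[rule_format, of q'] by eventually_elim linarith
    then show ?thesis by simp
  qed
  have "Cauchy c"
  proof (rule metric_CauchyI)
    fix e :: real assume "0 < e"
    then obtain M where M: "1 / real (Suc M) < e / 4" using nat_approx_posE[of "e / 4"] by auto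
    have "dist (c a) (c b) < e" if "M \<le> a" "M \<le> b" for a b
    proof -
      have "1 / real (Suc a) \<le> 1 / real (Suc M)" "1 / real (Suc b) \<le> 1 / real (Suc M)"
        using that by (auto intro!: divide_left_mono)
      then show ?thesis using Cauchy_c[of a b] M by (simp add: dist_real_def)
    qed
    then show "\<exists>M. \<forall>m\<ge>M. \<forall>n\<ge>M. dist (c m) (c n) < e" by blast
  qed
  then obtain l where l: "c \<longlonglongrightarrow> l" using Cauchy_convergent convergent_def by blast
  have "AE \<omega> in noise_seq \<epsilon>. A \<omega> x \<longlonglongrightarrow> l" if "x \<in> trap_union" for x
    using close[OF that]
  proof eventually_elim
    case (elim \<omega>)
    show ?case
    proof (rule tendstoI)
      fix e :: real assume e: "0 < e"
      have "(\<lambda>q. 2 / real (Suc q) + \<bar>c q - l\<bar>) \<longlonglongrightarrow> 0 + \<bar>l - l\<bar>"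
        by (intro tendsto_intros l) real_asymp
      then have "\<forall>\<^sub>F q in sequentially. 2 / real (Suc q) + \<bar>c q - l\<bar> < e"
        by (rule order_tendstoD(2)) (use e in simp)
      then obtain q where q: "2 / real (Suc q) + \<bar>c q - l\<bar> < e"
        using eventually_happens'[OF sequentially_bot] by blast
      show "\<forall>\<^sub>F n in sequentially. dist (A \<omega> x n) l < e"
        using elim[rule_format, of q] by eventually_elim (use q in \<open>auto simp: dist_real_def\<close>)
    qed
  qed
  then show ?thesis unfolding A_def by blast
qed

end

section \<open>The stationary law of a contracting cycle\<close>

context contracting_cycle
begin

text \<open>
  Noise sequences leave \<open>[-\<epsilon>,\<epsilon>]\<close> on a null set only; truncation makes the backward iteration converge for
  every sequence, so that its limit is a measurable function defined everywhere.
\<close>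

definition clamp_noise :: "real \<Rightarrow> real" where
  "clamp_noise w = max (- \<epsilon>) (min \<epsilon> w)"

lemma clamp_noise_range: "clamp_noise w \<in> {-\<epsilon>..\<epsilon>}"
  using eps_pos by (auto simp: clamp_noise_def)

lemma clamp_noise_id: "w \<in> {-\<epsilon>..\<epsilon>} \<Longrightarrow> clamp_noise w = w"
  by (auto simp: clamp_noise_def)

lemma clamp_noise_measurable [measurable]: "clamp_noise \<in> borel_measurable borel"
  unfolding clamp_noise_def by measurable

text \<open>
  The composition of \<open>n\<close> noisy steps in which \<open>\<omega> 0\<close> is applied last, started at the cycle
  point for which the result has phase \<open>i\<close>.  The previous phase is written \<open>i + N - 1\<close> since \<open>i - 1\<close> would
  be wrong at \<open>i = 0\<close>.
\<close>

primrec backward_orbit :: "nat \<Rightarrow> nat \<Rightarrow> (nat \<Rightarrow> real) \<Rightarrow> real" where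
  "backward_orbit 0 i \<omega> = p i"
| "backward_orbit (Suc n) i \<omega> =
     F (backward_orbit n (i + N - 1) (\<lambda>j. \<omega> (Suc j)) + clamp_noise (\<omega> 0))"

lemma measurable_backward_orbit [measurable (raw)]:
  assumes "f \<in> measurable M (PiM UNIV (\<lambda>_. borel))"
  shows "(\<lambda>x. backward_orbit n i (f x)) \<in> borel_measurable M"
  using assms
proof (induction n arbitrary: i f)
  case (Suc n)
  note [measurable] = Suc.prems
  have "(\<lambda>x. (\<lambda>j. f x (Suc j))) \<in> measurable M (PiM UNIV (\<lambda>_. borel))"
    by (rule measurable_PiM_single') auto
  from Suc.IH[OF this] have [measurable]:
    "(\<lambda>x. backward_orbit n (i + N - 1) (\<lambda>j. f x (Suc j))) \<in> borel_measurable M" .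
  show ?case unfolding backward_orbit.simps by measurable
qed simp

lemma backward_orbit_trap: "backward_orbit n i \<omega> \<in> trap i"
proof (induction n arbitrary: i \<omega>)
  case 0
  then show ?case using r_pos[of i] by (simp add: trap_def)
next
  case (Suc n)
  have "Suc (i + N - 1) = i + N" using N_pos by simp
  then show ?case using F_trap[OF Suc clamp_noise_range] by (metis backward_orbit.simps(2) trap_period)
qed

text \<open>
  The two compositions differ only in their innermost step, whose effect is contracted \<open>n\<close> times.
\<close>

lemma backward_orbit_step: "\<bar>backward_orbit (Suc n) i \<omega> - backward_orbit n i \<omega>\<bar> \<le> \<theta> ^ n * r i"
proof (induction n arbitrary: i \<omega>)
  case 0
  show ?case using backward_orbit_trap[of "Suc 0" i \<omega>] by (simp add: trap_def)
next
  case (Suc n)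
  define k where "k = i + N - 1"
  have k: "Suc k = i + N" using N_pos by (simp add: k_def)
  let ?b = "\<lambda>n. backward_orbit n k (\<lambda>j. \<omega> (Suc j))"
  have "\<bar>F (?b (Suc n) + clamp_noise (\<omega> 0)) - F (?b n + clamp_noise (\<omega> 0))\<bar> * r k
      \<le> \<theta> * r (Suc k) * \<bar>?b (Suc n) - ?b n\<bar>"
    by (rule F_contracts_trap[OF backward_orbit_trap backward_orbit_trap clamp_noise_range])
  also have "\<dots> \<le> \<theta> * r (Suc k) * (\<theta> ^ n * r k)"
    using theta r_pos[of "Suc k"] by (intro mult_left_mono Suc) auto
  also have "\<dots> = (\<theta> ^ Suc n * r i) * r k" using r_period[of i] by (simp add: k)
  finally show ?case using r_pos[of k] by (simp add: k_def[symmetric] del: backward_orbit.simps(2)) (simp add: k_def)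
qed

lemma backward_orbit_convergent: "convergent (\<lambda>n. backward_orbit n i \<omega>)"
proof -
  have "summable (\<lambda>n. backward_orbit (Suc n) i \<omega> - backward_orbit n i \<omega>)"
  proof (rule summable_comparison_test[OF _ summable_mult2[OF summable_geometric]])
    show "\<exists>M. \<forall>n\<ge>M. norm (backward_orbit (Suc n) i \<omega> - backward_orbit n i \<omega>) \<le> \<theta> ^ n * r i"
      using backward_orbit_step[of _ i \<omega>] by (simp del: backward_orbit.simps)
    show "norm \<theta> < 1" using theta by simp
  qed
  then have "convergent (\<lambda>n. \<Sum>k<n. backward_orbit (Suc k) i \<omega> - backward_orbit k i \<omega>)"
    by (simp only: summable_iff_convergent)
  moreover have "(\<Sum>k<n. backward_orbit (Suc k) i \<omega> - backward_orbit k i \<omega>)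
      = backward_orbit n i \<omega> - backward_orbit 0 i \<omega>" for n
    by (rule sum_lessThan_telescope)
  ultimately have "convergent (\<lambda>n. backward_orbit n i \<omega> - backward_orbit 0 i \<omega>)"
    by (simp only:)
  then show ?thesis
    by (rule convergent_diff_const_right_iff[THEN iffD1])
qed

definition pullback_limit :: "nat \<Rightarrow> (nat \<Rightarrow> real) \<Rightarrow> real" where
  "pullback_limit i \<omega> = lim (\<lambda>n. backward_orbit n i \<omega>)"

lemma backward_orbit_tendsto: "(\<lambda>n. backward_orbit n i \<omega>) \<longlonglongrightarrow> pullback_limit i \<omega>"
  unfolding pullback_limit_def using backward_orbit_convergent by (simp add: convergent_LIMSEQ_iff)

lemma measurable_pullback_limit [measurable]:
  "pullback_limit i \<in> borel_measurable (noise_seq \<epsilon>)"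
proof (rule borel_measurable_LIMSEQ_real)
  show "(\<lambda>n. backward_orbit n i \<omega>) \<longlonglongrightarrow> pullback_limit i \<omega>" for \<omega> by (rule backward_orbit_tendsto)
  show "(\<lambda>\<omega>. backward_orbit n i \<omega>) \<in> borel_measurable (noise_seq \<epsilon>)" for n by measurable
qed

lemma pullback_limit_trap: "pullback_limit i \<omega> \<in> trap i"
proof -
  have "closed (trap i)" unfolding trap_def by (intro closed_Collect_le continuous_intros)
  then show ?thesis
    by (rule closed_sequentially[OF _ _ backward_orbit_tendsto]) (rule backward_orbit_trap)
qed

lemma backward_orbit_period: "backward_orbit n (i + N) \<omega> = backward_orbit n i \<omega>"
proof (induction n arbitrary: i \<omega>)
  case (Suc n)
  have "i + N + N - 1 = (i + N - 1) + N" using N_pos by simp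
  then show ?case using Suc[of "i + N - 1"] by simp
qed (simp add: p_period)

lemma pullback_limit_period: "pullback_limit (i + N) \<omega> = pullback_limit i \<omega>"
  by (simp add: pullback_limit_def backward_orbit_period)

text \<open>
  A new noise value in front of the past moves the pullback limit by one step of the chain;
  this identity is the reason for the stationarity of its law.
\<close>

lemma pullback_limit_Suc:
  "pullback_limit (Suc i) (case_nat w \<omega>) = F (pullback_limit i \<omega> + clamp_noise w)"
proof -
  have "(\<lambda>n. backward_orbit (Suc n) (Suc i) (case_nat w \<omega>)) \<longlonglongrightarrow> F (pullback_limit i \<omega> + clamp_noise w)"
    using backward_orbit_tendsto[of i \<omega>]
    by (auto simp: backward_orbit_period intro!: isCont_tendsto_compose[of _ F] tendsto_intros DERIV_isCont[OF F_deriv])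
  moreover have "(\<lambda>n. backward_orbit (Suc n) (Suc i) (case_nat w \<omega>)) \<longlonglongrightarrow> pullback_limit (Suc i) (case_nat w \<omega>)"
    by (rule LIMSEQ_Suc[OF backward_orbit_tendsto])
  ultimately show ?thesis by (rule LIMSEQ_unique[symmetric])
qed

lemma pullback_limit_law_Suc:
  assumes B [measurable]: "B \<in> sets borel"
  shows "emeasure (noise_seq \<epsilon>) {\<omega>. pullback_limit (Suc i) \<omega> \<in> B}
    = (\<integral>\<^sup>+ \<omega>. emeasure (noise \<epsilon>) {w\<in>{-\<epsilon>..\<epsilon>}. F (pullback_limit i \<omega> + w) \<in> B} \<partial>noise_seq \<epsilon>)"
proof -
  interpret S': prob_space "noise_seq \<epsilon>" by (rule prob_space_noise_seq)
  interpret P: pair_prob_space "noise \<epsilon>" "noise_seq \<epsilon>" ..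
  have "{\<omega>. pullback_limit (Suc i) \<omega> \<in> B} = pullback_limit (Suc i) -` B \<inter> space (noise_seq \<epsilon>)" by auto
  then have m: "{\<omega>. pullback_limit (Suc i) \<omega> \<in> B} \<in> sets (noise_seq \<epsilon>)"
    using measurable_sets[OF measurable_pullback_limit B] by simp
  have "emeasure (noise_seq \<epsilon>) {\<omega>. pullback_limit (Suc i) \<omega> \<in> B}
      = (\<integral>\<^sup>+ \<omega>. indicator B (pullback_limit (Suc i) \<omega>) \<partial>noise_seq \<epsilon>)"
    by (subst nn_integral_indicator[OF m, symmetric]) (auto intro!: nn_integral_cong split: split_indicator)
  also have "\<dots> = (\<integral>\<^sup>+ w. \<integral>\<^sup>+ \<omega>. indicator B (F (pullback_limit i \<omega> + clamp_noise w)) \<partial>noise_seq \<epsilon> \<partial>noise \<epsilon>)"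
    by (subst nn_integral_noise_seq_shift) (auto simp: pullback_limit_Suc)
  also have "\<dots> = (\<integral>\<^sup>+ \<omega>. \<integral>\<^sup>+ w. indicator B (F (pullback_limit i \<omega> + clamp_noise w)) \<partial>noise \<epsilon> \<partial>noise_seq \<epsilon>)"
    by (rule P.Fubini'[symmetric]) measurable
  also have "\<dots> = (\<integral>\<^sup>+ \<omega>. emeasure (noise \<epsilon>) {w\<in>{-\<epsilon>..\<epsilon>}. F (pullback_limit i \<omega> + w) \<in> B} \<partial>noise_seq \<epsilon>)"
  proof (intro nn_integral_cong)
    fix \<omega>
    let ?A = "{w\<in>{-\<epsilon>..\<epsilon>}. F (pullback_limit i \<omega> + w) \<in> B}"
    have A: "?A \<in> sets (noise \<epsilon>)" by simp measurable
    have "(\<integral>\<^sup>+ w. indicator B (F (pullback_limit i \<omega> + clamp_noise w)) \<partial>noise \<epsilon>) = (\<integral>\<^sup>+ w. indicator ?A w \<partial>noise \<epsilon>)"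
    proof (rule nn_integral_cong_AE)
      show "AE w in noise \<epsilon>. indicator B (F (pullback_limit i \<omega> + clamp_noise w)) = indicator ?A w"
        using AE_noise[OF eps_pos] by eventually_elim (auto simp: clamp_noise_id split: split_indicator)
    qed
    then show "(\<integral>\<^sup>+ w. indicator B (F (pullback_limit i \<omega> + clamp_noise w)) \<partial>noise \<epsilon>) = emeasure (noise \<epsilon>) ?A"
      using A by simp
  qed
  finally show ?thesis .
qed

text \<open>
  A pullback limit of fixed phase \<open>i\<close> is mapped to one of phase \<open>Suc i\<close>, so its law is only periodic;
  choosing the phase uniformly makes the law stationary.
\<close>

definition cycle_law :: "real measure" where
  "cycle_law = distr (measure_pmf (pmf_of_set {..<N}) \<Otimes>\<^sub>M noise_seq \<epsilon>) borel
                 (\<lambda>(i, \<omega>). pullback_limit i \<omega>)"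

lemma sets_cycle_law [simp, measurable_cong]: "sets cycle_law = sets borel"
  by (simp add: cycle_law_def)

lemma space_cycle_law [simp]: "space cycle_law = UNIV"
  by (simp add: cycle_law_def)

lemma measurable_pullback_pair [measurable]:
  "(\<lambda>(i, \<omega>). pullback_limit i \<omega>) \<in> borel_measurable (measure_pmf (pmf_of_set {..<N}) \<Otimes>\<^sub>M noise_seq \<epsilon>)"
proof -
  have "(\<lambda>(i, \<omega>). pullback_limit i \<omega>) \<in> borel_measurable (count_space UNIV \<Otimes>\<^sub>M noise_seq \<epsilon>)"
    by (rule measurable_pair_measure_countable1) auto
  then show ?thesis by (simp cong: measurable_cong_sets)
qed

lemma prob_space_cycle_law: "prob_space cycle_law"
  unfolding cycle_law_def
  by (intro prob_space.prob_space_distr prob_space_pair measure_pmf.prob_space_axioms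
      prob_space_noise_seq measurable_pullback_pair)

lemma nn_integral_cycle_law:
  assumes [measurable]: "f \<in> borel_measurable borel"
  shows "(\<integral>\<^sup>+ x. f x \<partial>cycle_law) = (\<Sum>i<N. \<integral>\<^sup>+ \<omega>. f (pullback_limit i \<omega>) \<partial>noise_seq \<epsilon>) / of_nat N"
proof -
  interpret S': prob_space "noise_seq \<epsilon>" by (rule prob_space_noise_seq)
  have "(\<integral>\<^sup>+ x. f x \<partial>cycle_law)
      = (\<integral>\<^sup>+ z. f (case z of (i, \<omega>) \<Rightarrow> pullback_limit i \<omega>) \<partial>(measure_pmf (pmf_of_set {..<N}) \<Otimes>\<^sub>M noise_seq \<epsilon>))"
    unfolding cycle_law_def by (subst nn_integral_distr) auto
  also have "\<dots> = (\<integral>\<^sup>+ i. \<integral>\<^sup>+ \<omega>. f (pullback_limit i \<omega>) \<partial>noise_seq \<epsilon> \<partial>measure_pmf (pmf_of_set {..<N}))"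
    by (subst S'.nn_integral_fst[symmetric]) auto
  also have "\<dots> = (\<Sum>i<N. \<integral>\<^sup>+ \<omega>. f (pullback_limit i \<omega>) \<partial>noise_seq \<epsilon>) / of_nat N"
    using N_pos by (subst nn_integral_pmf_of_set) auto
  finally show ?thesis .
qed

lemma emeasure_cycle_law:
  assumes B [measurable]: "B \<in> sets borel"
  shows "emeasure cycle_law B = (\<Sum>i<N. emeasure (noise_seq \<epsilon>) {\<omega>. pullback_limit i \<omega> \<in> B}) / of_nat N"
proof -
  have eq: "(\<integral>\<^sup>+ \<omega>. indicator B (pullback_limit i \<omega>) \<partial>noise_seq \<epsilon>)
      = emeasure (noise_seq \<epsilon>) {\<omega>. pullback_limit i \<omega> \<in> B}" for i
  proof -
    have "{\<omega>. pullback_limit i \<omega> \<in> B} = pullback_limit i -` B \<inter> space (noise_seq \<epsilon>)" by auto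
    then have m: "{\<omega>. pullback_limit i \<omega> \<in> B} \<in> sets (noise_seq \<epsilon>)"
      using measurable_sets[OF measurable_pullback_limit B] by simp
    show ?thesis
      by (subst nn_integral_indicator[OF m, symmetric]) (auto intro!: nn_integral_cong split: split_indicator)
  qed
  have "emeasure cycle_law B = (\<integral>\<^sup>+ x. indicator B x \<partial>cycle_law)"
    by (simp add: B)
  also have "\<dots> = (\<Sum>i<N. \<integral>\<^sup>+ \<omega>. indicator B (pullback_limit i \<omega>) \<partial>noise_seq \<epsilon>) / of_nat N"
    by (rule nn_integral_cycle_law) measurable
  finally show ?thesis unfolding eq .
qed

lemma AE_cycle_law_trap: "AE x in cycle_law. x \<in> trap_union"
proof -
  have m: "trap_union \<in> sets borel"
    unfolding trap_union_def trap_def by measurable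
  have "(AE x in cycle_law. x \<in> trap_union) \<longleftrightarrow>
      (AE z in measure_pmf (pmf_of_set {..<N}) \<Otimes>\<^sub>M noise_seq \<epsilon>. (case z of (i, \<omega>) \<Rightarrow> pullback_limit i \<omega>) \<in> trap_union)"
    unfolding cycle_law_def using m by (intro AE_distr_iff) auto
  then show ?thesis using pullback_limit_trap by (auto simp: trap_union_def intro!: AE_I2)
qed

lemma cycle_law_stationary:
  assumes B [measurable]: "B \<in> sets borel"
  shows "emeasure cycle_law B
    = (\<integral>\<^sup>+ x. emeasure (noise \<epsilon>) {w\<in>{-\<epsilon>..\<epsilon>}. F (x + w) \<in> B} \<partial>cycle_law)"
proof -
  let ?e = "\<lambda>i. emeasure (noise_seq \<epsilon>) {\<omega>. pullback_limit i \<omega> \<in> B}"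
  have meas: "(\<lambda>x. emeasure (noise \<epsilon>) {w\<in>{-\<epsilon>..\<epsilon>}. F (x + w) \<in> B}) \<in> borel_measurable borel"
    by measurable
  have "(\<integral>\<^sup>+ x. emeasure (noise \<epsilon>) {w\<in>{-\<epsilon>..\<epsilon>}. F (x + w) \<in> B} \<partial>cycle_law) = (\<Sum>i<N. ?e (Suc i)) / of_nat N"
    unfolding nn_integral_cycle_law[OF meas] pullback_limit_law_Suc[OF B] ..
  also have "(\<Sum>i<N. ?e (Suc i)) = (\<Sum>i<N. ?e i)"
  proof -
    obtain K where K: "N = Suc K" using N_pos by (cases N) auto
    have "?e N = ?e 0" using pullback_limit_period[of 0] by simp
    then show ?thesis unfolding K by (subst (2) sum.lessThan_Suc_shift) (simp add: K add.commute)
  qed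
  finally show ?thesis by (simp add: emeasure_cycle_law B)
qed

end

section \<open>The exponent on the line\<close>

lemma nn_integral_noise_translate:
  assumes "0 < \<epsilon>" and [measurable]: "f \<in> borel_measurable borel"
  shows "(\<integral>\<^sup>+ w. f (x + w) \<partial>noise \<epsilon>) = (\<integral>\<^sup>+ y. f y * indicator {x - \<epsilon>..x + \<epsilon>} y \<partial>lborel) / ennreal (2 * \<epsilon>)"
proof -
  have "(\<integral>\<^sup>+ w. f (x + w) \<partial>noise \<epsilon>) = (\<integral>\<^sup>+ w. f (x + w) * indicator {-\<epsilon>..\<epsilon>} w \<partial>lborel) / ennreal (2 * \<epsilon>)"
    unfolding noise_def using assms(1) by (subst nn_integral_uniform_measure) auto
  also have "(\<integral>\<^sup>+ w. f (x + w) * indicator {-\<epsilon>..\<epsilon>} w \<partial>lborel)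
      = (\<integral>\<^sup>+ w. f (x + 1 * w) * indicator {x - \<epsilon>..x + \<epsilon>} (x + 1 * w) \<partial>lborel)"
    by (intro nn_integral_cong) (auto split: split_indicator)
  also have "\<dots> = (\<integral>\<^sup>+ y. f y * indicator {x - \<epsilon>..x + \<epsilon>} y \<partial>lborel)"
    using nn_integral_real_affine[of "\<lambda>y. f y * indicator {x - \<epsilon>..x + \<epsilon>} y" 1 x] by simp
  finally show ?thesis .
qed

lemma AE_noise_not_countable:
  assumes "0 < \<epsilon>" "countable Z"
  shows "AE w in noise \<epsilon>. x + w \<notin> Z"
proof -
  have "countable ((\<lambda>y. y - x) ` Z)" using assms by simp
  then have "AE w in lborel. w \<notin> (\<lambda>y. y - x) ` Z"
    by (intro AE_not_in countable_imp_null_set_lborel)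
  then have "AE w in lborel. w \<in> {-\<epsilon>..\<epsilon>} \<longrightarrow> x + w \<notin> Z"
    by eventually_elim (force simp: image_iff)
  then show ?thesis unfolding noise_def by (intro AE_uniform_measureI) auto
qed

text \<open>
  The term \<open>1\<close> covers \<open>y = 0\<close>, where both \<open>ln\<close> and \<open>powr\<close> take the value \<open>0\<close>.
\<close>

lemma exp_half_abs_ln_le:
  fixes y :: real
  shows "exp (1 / 2 * \<bar>ln \<bar>y\<bar>\<bar>) \<le> 1 + \<bar>y\<bar> powr (1 / 2) + \<bar>y\<bar> powr (- 1 / 2)"
proof (cases "y = 0")
  case False
  then have "exp (1 / 2 * \<bar>ln \<bar>y\<bar>\<bar>) = \<bar>y\<bar> powr (1 / 2) \<or> exp (1 / 2 * \<bar>ln \<bar>y\<bar>\<bar>) = \<bar>y\<bar> powr (- 1 / 2)"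
    by (cases "0 \<le> ln \<bar>y\<bar>") (auto simp: powr_def)
  then show ?thesis using powr_ge_zero[of "\<bar>y\<bar>" "1 / 2"] powr_ge_zero[of "\<bar>y\<bar>" "- 1 / 2"] by linarith
qed simp

text \<open>
  Both additional assumptions follow if all zeros of \<open>F'\<close> are simple; they are what the exponent needs:
  the slope almost surely never vanishes, and its logarithm has exponential moments.
\<close>

locale contracting_cycle_nondegenerate = contracting_cycle +
  assumes critical_countable: "countable {y. F' y = 0}"
    and inverse_root_integrable:
      "(\<integral>\<^sup>+ y. ennreal (\<bar>F' y\<bar> powr (- 1 / 2)) * indicator {a..b} y \<partial>lborel) < \<infinity>"
begin

lemma F'_measurable [measurable]: "F' \<in> borel_measurable borel"
  using F'_cont by (rule borel_measurable_continuous_onI)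

lemma compact_trap_union: "compact trap_union"
proof -
  have "trap i = cball (p i) (r i)" for i by (auto simp: trap_def dist_real_def)
  then show ?thesis unfolding trap_union_eq by (intro compact_UN) auto
qed

lemma trap_union_interval: "\<exists>a b. \<forall>x\<in>trap_union. {x - \<epsilon>..x + \<epsilon>} \<subseteq> {a..b}"
proof -
  obtain a b where "trap_union \<subseteq> cbox a b"
    using bounded_subset_cbox_symmetric[OF compact_imp_bounded[OF compact_trap_union]] by metis
  then have "\<forall>x\<in>trap_union. {x - \<epsilon>..x + \<epsilon>} \<subseteq> {a - \<epsilon>..b + \<epsilon>}" by fastforce
  then show ?thesis by blast
qed

abbreviation "log_slope \<equiv> \<lambda>y. ln \<bar>F' y\<bar>"

lemma exp_moment_interval:
  "(\<integral>\<^sup>+ y. ennreal (exp (1 / 2 * \<bar>log_slope y\<bar>)) * indicator {a..b} y \<partial>lborel) < \<infinity>"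
proof -
  have "compact (F' ` {a..b})" by (intro compact_continuous_image continuous_on_subset[OF F'_cont]) auto
  then obtain M where M: "\<And>y. y \<in> {a..b} \<Longrightarrow> \<bar>F' y\<bar> \<le> M"
    using compact_imp_bounded bounded_iff by (metis image_eqI real_norm_def)
  define K where "K = 1 + \<bar>M\<bar> powr (1 / 2)"
  have "(\<integral>\<^sup>+ y. ennreal (exp (1 / 2 * \<bar>log_slope y\<bar>)) * indicator {a..b} y \<partial>lborel)
      \<le> (\<integral>\<^sup>+ y. ennreal K * indicator {a..b} y + ennreal (\<bar>F' y\<bar> powr (- 1 / 2)) * indicator {a..b} y \<partial>lborel)"
  proof (intro nn_integral_mono)
    fix y
    show "ennreal (exp (1 / 2 * \<bar>log_slope y\<bar>)) * indicator {a..b} y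
      \<le> ennreal K * indicator {a..b} y + ennreal (\<bar>F' y\<bar> powr (- 1 / 2)) * indicator {a..b} y"
    proof (cases "y \<in> {a..b}")
      case True
      have "\<bar>F' y\<bar> powr (1 / 2) \<le> \<bar>M\<bar> powr (1 / 2)" using M[OF True] by (intro powr_mono2) auto
      then have "exp (1 / 2 * \<bar>log_slope y\<bar>) \<le> K + \<bar>F' y\<bar> powr (- 1 / 2)"
        using exp_half_abs_ln_le[of "F' y"] by (simp add: K_def)
      then have "ennreal (exp (1 / 2 * \<bar>log_slope y\<bar>)) \<le> ennreal (K + \<bar>F' y\<bar> powr (- 1 / 2))"
        by (rule ennreal_leI)
      also have "\<dots> = ennreal K + ennreal (\<bar>F' y\<bar> powr (- 1 / 2))"
        by (rule ennreal_plus) (auto simp: K_def)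
      finally show ?thesis using True by simp
    qed auto
  qed
  also have "\<dots> = ennreal K * emeasure lborel {a..b}
      + (\<integral>\<^sup>+ y. ennreal (\<bar>F' y\<bar> powr (- 1 / 2)) * indicator {a..b} y \<partial>lborel)"
    by (subst nn_integral_add) (auto simp: nn_integral_cmult_indicator)
  also have "\<dots> < \<infinity>"
    using inverse_root_integrable[of a b] by (auto simp: ennreal_mult_less_top emeasure_lborel_Icc_eq)
  finally show ?thesis .
qed

lemma exp_moment_log_slope:
  "\<exists>C. \<forall>x\<in>trap_union. (\<integral>\<^sup>+ w. ennreal (exp (1 / 2 * \<bar>log_slope (x + w)\<bar>)) \<partial>noise \<epsilon>) \<le> ennreal C"
proof -
  obtain a b where ab: "\<And>x. x \<in> trap_union \<Longrightarrow> {x - \<epsilon>..x + \<epsilon>} \<subseteq> {a..b}" using trap_union_interval by blast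
  let ?J = "\<integral>\<^sup>+ y. ennreal (exp (1 / 2 * \<bar>log_slope y\<bar>)) * indicator {a..b} y \<partial>lborel"
  have "?J / ennreal (2 * \<epsilon>) < \<infinity>"
    using exp_moment_interval[of a b] eps_pos by (simp add: ennreal_divide_eq_top_iff less_top[symmetric])
  then obtain C where C: "?J / ennreal (2 * \<epsilon>) = ennreal C"
    by (metis ennreal_enn2real_if infinity_ennreal_def less_irrefl)
  have "(\<integral>\<^sup>+ w. ennreal (exp (1 / 2 * \<bar>log_slope (x + w)\<bar>)) \<partial>noise \<epsilon>) \<le> ennreal C" if "x \<in> trap_union" for x
  proof -
    have "(\<integral>\<^sup>+ w. ennreal (exp (1 / 2 * \<bar>log_slope (x + w)\<bar>)) \<partial>noise \<epsilon>)
      = (\<integral>\<^sup>+ y. ennreal (exp (1 / 2 * \<bar>log_slope y\<bar>)) * indicator {x - \<epsilon>..x + \<epsilon>} y \<partial>lborel) / ennreal (2 * \<epsilon>)"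
      by (rule nn_integral_noise_translate[OF eps_pos]) measurable
    also have "\<dots> \<le> ?J / ennreal (2 * \<epsilon>)"
      using ab[OF that]
      by (intro divide_right_mono_ennreal nn_integral_mono mult_left_mono)
        (auto simp del: atLeastatMost_subset_iff split: split_indicator)
    finally show ?thesis using C by simp
  qed
  then show ?thesis by blast
qed

text \<open>
  The noise has a constant density, so the mean is a difference of two values of an indefinite
  integral of the logarithm of the slope.  Continuity thus survives the singularities at the critical points.
\<close>

lemma mean_log_slope_uniformly_continuous:
  "uniformly_continuous_on trap_union (\<lambda>x. LINT w|noise \<epsilon>. log_slope (x + w))"
proof -
  obtain a b where ab: "\<And>x. x \<in> trap_union \<Longrightarrow> {x - \<epsilon>..x + \<epsilon>} \<subseteq> {a..b}" using trap_union_interval by blast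
  have exp_int: "integrable lborel (\<lambda>y. indicator {a..b} y * exp (1 / 2 * \<bar>log_slope y\<bar>))"
  proof (rule integrableI_bounded)
    have "(\<integral>\<^sup>+ y. ennreal (norm (indicator {a..b} y * exp (1 / 2 * \<bar>log_slope y\<bar>))) \<partial>lborel)
      = (\<integral>\<^sup>+ y. ennreal (exp (1 / 2 * \<bar>log_slope y\<bar>)) * indicator {a..b} y \<partial>lborel)"
      by (intro nn_integral_cong) (auto split: split_indicator)
    then show "(\<integral>\<^sup>+ y. ennreal (norm (indicator {a..b} y * exp (1 / 2 * \<bar>log_slope y\<bar>))) \<partial>lborel) < \<infinity>"
      using exp_moment_interval[of a b] by simp
  qed measurable
  have set_int: "set_integrable lborel {a..b} log_slope"
    unfolding set_integrable_def
  proof (rule Bochner_Integration.integrable_bound[of _ "\<lambda>y. 2 * (indicator {a..b} y * exp (1 / 2 * \<bar>log_slope y\<bar>))"])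
    have "\<bar>log_slope y\<bar> \<le> 2 * exp (1 / 2 * \<bar>log_slope y\<bar>)" for y
      using exp_ge_add_one_self[of "1 / 2 * \<bar>log_slope y\<bar>"] by linarith
    then show "AE y in lborel. norm (indicat_real {a..b} y *\<^sub>R log_slope y)
        \<le> norm (2 * (indicator {a..b} y * exp (1 / 2 * \<bar>log_slope y\<bar>)))"
      by (intro AE_I2) (auto split: split_indicator)
  qed (use exp_int in \<open>auto simp del: mult.assoc\<close>)
  have HK: "log_slope integrable_on {a..b}"
    using set_int by (rule set_borel_integral_eq_integral)
  define \<Gamma> where "\<Gamma> x = integral {a..x} log_slope" for x
  have \<Gamma>_cont: "continuous_on {a..b} \<Gamma>"
    unfolding \<Gamma>_def by (rule indefinite_integral_continuous_1[OF HK])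
  have eq: "(LINT w|noise \<epsilon>. log_slope (x + w)) = (\<Gamma> (x + \<epsilon>) - \<Gamma> (x - \<epsilon>)) / (2 * \<epsilon>)"
    if x: "x \<in> trap_union" for x
  proof -
    have sub: "{x - \<epsilon>..x + \<epsilon>} \<subseteq> {a..b}" by (rule ab[OF x])
    then have le: "a \<le> x - \<epsilon>" "x + \<epsilon> \<le> b" using eps_pos by auto
    have set_int': "set_integrable lborel {x - \<epsilon>..x + \<epsilon>} log_slope"
      by (rule set_integrable_subset[OF set_int _ sub]) simp
    have "(LINT w|noise \<epsilon>. log_slope (x + w)) = (LINT w|lborel. indicator {-\<epsilon>..\<epsilon>} w / (2 * \<epsilon>) * log_slope (x + w))"
    proof -
      have "noise \<epsilon> = density lborel (\<lambda>w. ennreal (indicator {-\<epsilon>..\<epsilon>} w / (2 * \<epsilon>)))"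
        unfolding noise_def uniform_measure_def
        using eps_pos by (intro density_cong) (auto simp: divide_ennreal[symmetric] split: split_indicator)
      then show ?thesis using eps_pos by (subst integral_real_density[symmetric]) auto
    qed
    also have "\<dots> = (LINT w|lborel. indicator {x - \<epsilon>..x + \<epsilon>} (x + 1 * w) * log_slope (x + 1 * w) / (2 * \<epsilon>))"
      by (intro Bochner_Integration.integral_cong) (auto split: split_indicator)
    also have "\<dots> = (LINT y|lborel. indicator {x - \<epsilon>..x + \<epsilon>} y * log_slope y / (2 * \<epsilon>))"
      using lborel_integral_real_affine[of 1 "\<lambda>y. indicator {x - \<epsilon>..x + \<epsilon>} y * log_slope y / (2 * \<epsilon>)" x] by auto
    also have "\<dots> = (LINT y:{x - \<epsilon>..x + \<epsilon>}|lborel. log_slope y) / (2 * \<epsilon>)"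
      by (simp add: set_lebesgue_integral_def)
    also have "(LINT y:{x - \<epsilon>..x + \<epsilon>}|lborel. log_slope y) = integral {x - \<epsilon>..x + \<epsilon>} log_slope"
      using set_int' by (rule set_borel_integral_eq_integral)
    also have "\<dots> = \<Gamma> (x + \<epsilon>) - \<Gamma> (x - \<epsilon>)"
    proof -
      have "log_slope integrable_on {a..x + \<epsilon>}"
        using HK le by (auto intro: integrable_on_subinterval)
      from Henstock_Kurzweil_Integration.integral_combine[OF _ _ this, of "x - \<epsilon>"]
      show ?thesis using le eps_pos by (simp add: \<Gamma>_def)
    qed
    finally show ?thesis .
  qed
  have sub: "(\<lambda>x. x + \<epsilon>) ` trap_union \<subseteq> {a..b}" "(\<lambda>x. x - \<epsilon>) ` trap_union \<subseteq> {a..b}"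
    using ab eps_pos by (auto simp: subset_eq)
  have "continuous_on trap_union (\<lambda>x. (\<Gamma> (x + \<epsilon>) - \<Gamma> (x - \<epsilon>)) / (2 * \<epsilon>))"
    using eps_pos
    by (intro continuous_intros continuous_on_compose2[OF \<Gamma>_cont _ sub(1)] continuous_on_compose2[OF \<Gamma>_cont _ sub(2)]) auto
  then have "continuous_on trap_union (\<lambda>x. LINT w|noise \<epsilon>. log_slope (x + w))"
    by (rule continuous_on_cong[THEN iffD1, rotated -1]) (auto simp: eq)
  then show ?thesis by (rule compact_uniformly_continuous[OF _ compact_trap_union])
qed

text \<open>
  The weight that is infinite on the zeros of the slope and \<open>1\<close> elsewhere has mean \<open>1\<close> in every
  step, so its product along the orbit has mean at most \<open>1\<close> and is finite almost surely.
\<close>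

lemma AE_slope_nonzero:
  assumes x: "x \<in> trap_union"
  shows "AE \<omega> in noise_seq \<epsilon>. \<forall>j. F' (orb \<omega> j x + \<omega> j) \<noteq> 0"
proof -
  define u where "u x w = (if F' (x + w) = 0 then \<infinity> else 1 :: ennreal)" for x w
  have u_meas [measurable]: "(\<lambda>(x, w). u x w) \<in> borel_measurable (borel \<Otimes>\<^sub>M borel)"
    unfolding u_def by measurable
  have u1: "(\<integral>\<^sup>+ w. u x w \<partial>noise \<epsilon>) \<le> 1" for x
  proof -
    have "AE w in noise \<epsilon>. x + w \<notin> {y. F' y = 0}"
      by (rule AE_noise_not_countable[OF eps_pos critical_countable])
    then have "AE w in noise \<epsilon>. u x w \<le> 1" by eventually_elim (simp add: u_def)
    then have "(\<integral>\<^sup>+ w. u x w \<partial>noise \<epsilon>) \<le> (\<integral>\<^sup>+ w. 1 \<partial>noise \<epsilon>)"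
      by (rule nn_integral_mono_AE)
    then show ?thesis by simp
  qed
  have "AE \<omega> in noise_seq \<epsilon>. \<forall>n. (\<Prod>j<n. u (orb \<omega> j x) (\<omega> j)) \<noteq> \<infinity>"
    unfolding AE_all_countable
  proof
    fix n
    have "(\<integral>\<^sup>+ \<omega>. (\<Prod>j<n. u (orb \<omega> j x) (\<omega> j)) \<partial>noise_seq \<epsilon>) \<noteq> \<infinity>"
      using nn_integral_product_along_orbit[OF u_meas invariant_trap_union u1 x, of n]
      by (auto simp: top_unique)
    then show "AE \<omega> in noise_seq \<epsilon>. (\<Prod>j<n. u (orb \<omega> j x) (\<omega> j)) \<noteq> \<infinity>"
      by (intro nn_integral_PInf_AE) measurable
  qed
  then show ?thesis
  proof eventually_elim
    case (elim \<omega>)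
    show ?case
    proof
      fix j
      have "1 \<le> (\<Prod>i<j. u (orb \<omega> i x) (\<omega> i))"
      proof (induction j)
        case (Suc j)
        from mult_mono[OF this, of 1 "u (orb \<omega> j x) (\<omega> j)"] show ?case by (simp add: u_def)
      qed simp
      then have "(\<Prod>i<j. u (orb \<omega> i x) (\<omega> i)) \<noteq> 0" by (metis not_one_le_zero)
      with elim[rule_format, of "Suc j"] show "F' (orb \<omega> j x + \<omega> j) \<noteq> 0"
        by (auto simp: u_def ennreal_mult_top)
    qed
  qed
qed

text \<open>
  The radii telescope along the orbit: each slope is at most \<open>\<theta> * r (Suc i) / r i\<close>.
\<close>

lemma slope_product_bound:
  assumes "x \<in> trap i" "\<forall>j. \<omega> j \<in> {-\<epsilon>..\<epsilon>}"
  shows "(\<Prod>j<n. \<bar>F' (orb \<omega> j x + \<omega> j)\<bar>) * r i \<le> \<theta> ^ n * r (i + n)"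
proof (induction n)
  case (Suc n)
  have "orb \<omega> n x \<in> trap (i + n)"
    using assms by (induction n) (auto intro: F_trap)
  then have "\<bar>F' (orb \<omega> n x + \<omega> n)\<bar> * r (i + n) \<le> \<theta> * r (Suc (i + n))"
    using assms(2)[rule_format, of n] by (intro contr) (auto simp: trap_def)
  then have "\<theta> ^ n * (\<bar>F' (orb \<omega> n x + \<omega> n)\<bar> * r (i + n)) \<le> \<theta> ^ n * (\<theta> * r (Suc (i + n)))"
    using theta by (intro mult_left_mono) auto
  moreover have "(\<Prod>j<n. \<bar>F' (orb \<omega> j x + \<omega> j)\<bar>) * r i * \<bar>F' (orb \<omega> n x + \<omega> n)\<bar>
      \<le> \<theta> ^ n * r (i + n) * \<bar>F' (orb \<omega> n x + \<omega> n)\<bar>"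
    by (intro mult_right_mono Suc) auto
  ultimately show ?case by (simp add: mult.commute mult.left_commute)
qed simp

text \<open>
  Since the radii are bounded, \<open>slope_product_bound\<close> gives \<open>l \<le> ln \<theta>\<close> along a single
  typical orbit, and the limit is the same for all of them.
\<close>

lemma negative_exponent_on_line:
  "\<exists>l<0. \<forall>x\<in>trap_union. AE \<omega> in noise_seq \<epsilon>. (\<forall>j. F' (orb \<omega> j x + \<omega> j) \<noteq> 0) \<and>
     (\<lambda>n. (\<Sum>j<n. log_slope (orb \<omega> j x + \<omega> j)) / real n) \<longlonglongrightarrow> l"
proof -
  obtain C where C: "\<And>x. x \<in> trap_union \<Longrightarrow>
      (\<integral>\<^sup>+ w. ennreal (exp (1 / 2 * \<bar>log_slope (x + w)\<bar>)) \<partial>noise \<epsilon>) \<le> ennreal C"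
    using exp_moment_log_slope by blast
  have "bounded ((\<lambda>x. LINT w|noise \<epsilon>. log_slope (x + w)) ` trap_union)"
    by (intro compact_imp_bounded compact_continuous_image uniformly_continuous_imp_continuous
        mean_log_slope_uniformly_continuous compact_trap_union)
  then obtain B where B: "\<And>x. x \<in> trap_union \<Longrightarrow> \<bar>LINT w|noise \<epsilon>. log_slope (x + w)\<bar> \<le> B"
    unfolding bounded_iff by fastforce
  have "log_slope \<in> borel_measurable borel" by measurable
  from birkhoff_average_constant[OF this _ C B mean_log_slope_uniformly_continuous]
  obtain l where l: "\<And>x. x \<in> trap_union \<Longrightarrow> AE \<omega> in noise_seq \<epsilon>.
      (\<lambda>n. (\<Sum>j<n. log_slope (orb \<omega> j x + \<omega> j)) / real n) \<longlonglongrightarrow> l"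
    by auto
  have p0: "p 0 \<in> trap 0" using r_pos[of 0] by (simp add: trap_def)
  then have p0': "p 0 \<in> trap_union" by (auto simp: trap_union_def)
  interpret S': prob_space "noise_seq \<epsilon>" by (rule prob_space_noise_seq)
  have "AE \<omega> in noise_seq \<epsilon>. (\<forall>j. \<omega> j \<in> {-\<epsilon>..\<epsilon>}) \<and> (\<forall>j. F' (orb \<omega> j (p 0) + \<omega> j) \<noteq> 0) \<and>
      (\<lambda>n. (\<Sum>j<n. log_slope (orb \<omega> j (p 0) + \<omega> j)) / real n) \<longlonglongrightarrow> l"
    using AE_noise_seq AE_slope_nonzero[OF p0'] l[OF p0'] by eventually_elim blast
  then obtain \<omega> where \<omega>: "\<forall>j. \<omega> j \<in> {-\<epsilon>..\<epsilon>}" "\<And>j. F' (orb \<omega> j (p 0) + \<omega> j) \<noteq> 0"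
      "(\<lambda>n. (\<Sum>j<n. log_slope (orb \<omega> j (p 0) + \<omega> j)) / real n) \<longlonglongrightarrow> l"
    using eventually_happens'[OF S'.ae_filter_bot] by blast
  obtain R where R: "0 < R" "\<And>i. r i \<le> R" using r_bound by blast
  have "l \<le> ln \<theta>"
  proof (rule LIMSEQ_le[OF \<omega>(3)])
    show "(\<lambda>n. ln \<theta> + ln (R / r 0) / real n) \<longlonglongrightarrow> ln \<theta>"
      by real_asymp
    show "\<exists>N. \<forall>n\<ge>N. (\<Sum>j<n. log_slope (orb \<omega> j (p 0) + \<omega> j)) / real n \<le> ln \<theta> + ln (R / r 0) / real n"
    proof (intro exI[of _ 1] allI impI)
      fix n :: nat assume n: "1 \<le> n"
      let ?P = "\<Prod>j<n. \<bar>F' (orb \<omega> j (p 0) + \<omega> j)\<bar>"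
      have P: "0 < ?P" using \<omega>(2) by (intro prod_pos) auto
      have "?P * r 0 \<le> \<theta> ^ n * r n" using slope_product_bound[OF p0 \<omega>(1), of n] by simp
      also have "\<dots> \<le> \<theta> ^ n * R" using theta R by (intro mult_left_mono) auto
      finally have "?P \<le> \<theta> ^ n * (R / r 0)" using r_pos[of 0] by (simp add: field_simps)
      then have "ln ?P \<le> ln (\<theta> ^ n * (R / r 0))" using P by (intro ln_mono) auto
      also have "\<dots> = real n * ln \<theta> + ln (R / r 0)"
        using theta R r_pos[of 0] by (subst ln_mult) (auto simp: ln_realpow)
      also have "ln ?P = (\<Sum>j<n. log_slope (orb \<omega> j (p 0) + \<omega> j))"
        using \<omega>(2) by (intro ln_prod) auto
      finally show "(\<Sum>j<n. log_slope (orb \<omega> j (p 0) + \<omega> j)) / real n \<le> ln \<theta> + ln (R / r 0) / real n"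
        using n by (simp add: field_simps)
    qed
  qed
  also have "ln \<theta> < 0" using theta by simp
  finally have "l < 0" .
  moreover have "AE \<omega> in noise_seq \<epsilon>. (\<forall>j. F' (orb \<omega> j x + \<omega> j) \<noteq> 0) \<and>
     (\<lambda>n. (\<Sum>j<n. log_slope (orb \<omega> j x + \<omega> j)) / real n) \<longlonglongrightarrow> l" if "x \<in> trap_union" for x
    using AE_slope_nonzero[OF that] l[OF that] by eventually_elim blast
  ultimately show ?thesis by blast
qed

end

section \<open>Integrability of the inverse square root at simple zeros\<close>

lemma inverse_sqrt_integrable:
  fixes c d :: real
  assumes "0 \<le> d"
  shows "(\<integral>\<^sup>+ y. ennreal (\<bar>y - c\<bar> powr (- 1 / 2)) * indicator {c - d..c + d} y \<partial>lborel) < \<infinity>"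
proof -
  let ?h = "\<lambda>x :: real. indicator {0..d} x * ennreal (x powr (- 1 / 2))"
  have h: "(\<integral>\<^sup>+ x. ?h x \<partial>lborel) < \<infinity>"
  proof -
    obtain I where I: "((\<lambda>x :: real. x powr (- 1 / 2)) has_integral I) {0..d}"
      using has_integral_powr_from_0[of "- 1 / 2" d] assms by auto
    have "(\<integral>\<^sup>+ x. ennreal (indicator {0..d} x * x powr (- 1 / 2)) \<partial>lborel) = ennreal I"
      by (rule nn_integral_has_integral_lebesgue[OF _ I]) auto
    also have "(\<integral>\<^sup>+ x. ennreal (indicator {0..d} x * x powr (- 1 / 2)) \<partial>lborel) = (\<integral>\<^sup>+ x. ?h x \<partial>lborel)"
      by (intro nn_integral_cong) (auto split: split_indicator)
    finally show ?thesis by simp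
  qed
  have "(\<integral>\<^sup>+ y. ennreal (\<bar>y - c\<bar> powr (- 1 / 2)) * indicator {c - d..c + d} y \<partial>lborel)
      \<le> (\<integral>\<^sup>+ y. ?h (- c + 1 * y) + ?h (c + (- 1) * y) \<partial>lborel)"
    by (intro nn_integral_mono) (auto split: split_indicator)
  also have "\<dots> = (\<integral>\<^sup>+ y. ?h (- c + 1 * y) \<partial>lborel) + (\<integral>\<^sup>+ y. ?h (c + (- 1) * y) \<partial>lborel)"
    by (rule nn_integral_add) measurable
  also have "(\<integral>\<^sup>+ y. ?h (- c + 1 * y) \<partial>lborel) = (\<integral>\<^sup>+ x. ?h x \<partial>lborel)"
    using nn_integral_real_affine[of ?h 1 "- c"] by simp
  also have "(\<integral>\<^sup>+ y. ?h (c + (- 1) * y) \<partial>lborel) = (\<integral>\<^sup>+ x. ?h x \<partial>lborel)"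
    using nn_integral_real_affine[of ?h "- 1" c] by simp
  also have "(\<integral>\<^sup>+ x. ?h x \<partial>lborel) + (\<integral>\<^sup>+ x. ?h x \<partial>lborel) < \<infinity>" using h by simp
  finally show ?thesis .
qed

text \<open>
  Near a simple zero \<open>c\<close> the function is at least a multiple of \<open>\<bar>y - c\<bar>\<close>, near other points it is
  bounded away from zero.  Compactness, in the form of the Bolzano principle for intervals, glues
  these local bounds together.
\<close>

lemma inverse_sqrt_integrable_simple_zeros:
  fixes f :: "real \<Rightarrow> real"
  assumes cont: "continuous_on UNIV f"
    and zeros: "\<And>c. f c = 0 \<Longrightarrow> \<exists>m. m \<noteq> 0 \<and> (f has_real_derivative m) (at c)"
  shows "(\<integral>\<^sup>+ y. ennreal (\<bar>f y\<bar> powr (- 1 / 2)) * indicator {a..b} y \<partial>lborel) < \<infinity>"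
proof (cases "a \<le> b")
  case True
  have [measurable]: "f \<in> borel_measurable borel" by (rule borel_measurable_continuous_onI[OF cont])
  let ?J = "\<lambda>a b. \<integral>\<^sup>+ y. ennreal (\<bar>f y\<bar> powr (- 1 / 2)) * indicator {a..b} y \<partial>lborel"
  have mono: "?J a' b' \<le> ?J a b" if "{a'..b'} \<subseteq> {a..b}" for a b a' b'
    using that by (intro nn_integral_mono mult_left_mono)
      (auto simp del: atLeastatMost_subset_iff split: split_indicator)
  have loc: "\<exists>d>0. ?J (x - d) (x + d) < \<infinity>" for x
  proof (cases "f x = 0")
    case False
    have "isCont f x" using cont by (simp add: continuous_on_eq_continuous_at)
    then obtain d where d: "0 < d" "\<And>y. \<bar>y - x\<bar> < d \<Longrightarrow> \<bar>f y - f x\<bar> < \<bar>f x\<bar> / 2"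
      unfolding continuous_at_eps_delta dist_real_def using False
      by (metis half_gt_zero zero_less_abs_iff)
    define K where "K = (\<bar>f x\<bar> / 2) powr (- 1 / 2)"
    have "?J (x - d / 2) (x + d / 2) \<le> (\<integral>\<^sup>+ y. ennreal K * indicator {x - d / 2..x + d / 2} y \<partial>lborel)"
    proof (intro nn_integral_mono)
      fix y
      have "\<bar>f y\<bar> powr (- 1 / 2) \<le> K" if "y \<in> {x - d / 2..x + d / 2}"
      proof -
        have "\<bar>y - x\<bar> < d" using that d(1) by auto
        from d(2)[OF this] have "\<bar>f x\<bar> / 2 \<le> \<bar>f y\<bar>" by linarith
        then show ?thesis unfolding K_def using False by (intro powr_mono2') auto
      qed
      then show "ennreal (\<bar>f y\<bar> powr (- 1 / 2)) * indicator {x - d / 2..x + d / 2} y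
          \<le> ennreal K * indicator {x - d / 2..x + d / 2} y"
        by (auto intro!: ennreal_leI split: split_indicator)
    qed
    also have "\<dots> < \<infinity>"
      by (simp add: nn_integral_cmult_indicator ennreal_mult_less_top emeasure_lborel_Icc_eq)
    finally show ?thesis using d(1) by (intro exI[of _ "d / 2"]) auto
  next
    case fx: True
    then obtain m where m: "m \<noteq> 0" "(f has_real_derivative m) (at x)" using zeros by blast
    have "((\<lambda>y. (f y - f x) / (y - x)) \<longlongrightarrow> m) (at x)"
      using m(2) by (simp add: has_field_derivative_iff)
    then have "\<forall>\<^sub>F y in at x. dist ((f y - f x) / (y - x)) m < \<bar>m\<bar> / 2"
      by (rule tendstoD) (use m in simp)
    then obtain d where d: "0 < d"
      "\<And>y. y \<noteq> x \<Longrightarrow> dist y x < d \<Longrightarrow> dist ((f y - f x) / (y - x)) m < \<bar>m\<bar> / 2"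
      unfolding eventually_at by auto
    define K where "K = (\<bar>m\<bar> / 2) powr (- 1 / 2)"
    have "?J (x - d / 2) (x + d / 2) \<le> (\<integral>\<^sup>+ y. ennreal K *
        (ennreal (\<bar>y - x\<bar> powr (- 1 / 2)) * indicator {x - d / 2..x + d / 2} y) \<partial>lborel)"
    proof (intro nn_integral_mono)
      fix y
      have "\<bar>f y\<bar> powr (- 1 / 2) \<le> K * \<bar>y - x\<bar> powr (- 1 / 2)" if "y \<in> {x - d / 2..x + d / 2}"
      proof (cases "y = x")
        case False
        have "dist y x < d" using that d(1) by (auto simp: dist_real_def)
        from d(2)[OF False this] have "\<bar>f y / (y - x) - m\<bar> < \<bar>m\<bar> / 2"
          by (simp add: dist_real_def fx)
        then have "\<bar>m\<bar> / 2 \<le> \<bar>f y / (y - x)\<bar>" by linarith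
        then have "\<bar>m\<bar> / 2 * \<bar>y - x\<bar> \<le> \<bar>f y\<bar>" using False by (simp add: field_simps)
        then have "\<bar>f y\<bar> powr (- 1 / 2) \<le> (\<bar>m\<bar> / 2 * \<bar>y - x\<bar>) powr (- 1 / 2)"
          using m False by (intro powr_mono2') auto
        also have "\<dots> = K * \<bar>y - x\<bar> powr (- 1 / 2)"
          unfolding K_def by (rule powr_mult) 
        finally show ?thesis .
      qed (simp add: fx)
      then show "ennreal (\<bar>f y\<bar> powr (- 1 / 2)) * indicator {x - d / 2..x + d / 2} y
          \<le> ennreal K * (ennreal (\<bar>y - x\<bar> powr (- 1 / 2)) * indicator {x - d / 2..x + d / 2} y)"
        by (auto simp: K_def intro!: ennreal_leI split: split_indicator simp flip: ennreal_mult)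
    qed
    also have "\<dots> = ennreal K * (\<integral>\<^sup>+ y. ennreal (\<bar>y - x\<bar> powr (- 1 / 2)) * indicator {x - d / 2..x + d / 2} y \<partial>lborel)"
      by (rule nn_integral_cmult) measurable
    also have "\<dots> < \<infinity>"
      using inverse_sqrt_integrable[of "d / 2" x] d(1) by (simp add: ennreal_mult_less_top)
    finally show ?thesis using d(1) by (intro exI[of _ "d / 2"]) auto
  qed
  show ?thesis using True
  proof (induction rule: Bolzano)
    case (trans a b c)
    have "?J a c \<le> (\<integral>\<^sup>+ y. ennreal (\<bar>f y\<bar> powr (- 1 / 2)) * indicator {a..b} y
        + ennreal (\<bar>f y\<bar> powr (- 1 / 2)) * indicator {b..c} y \<partial>lborel)"
      by (intro nn_integral_mono) (auto split: split_indicator)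
    also have "\<dots> = ?J a b + ?J b c" by (rule nn_integral_add) measurable
    also have "\<dots> < \<infinity>" using trans by simp
    finally show ?case .
  next
    case (local x)
    obtain d where d: "0 < d" "?J (x - d) (x + d) < \<infinity>" using loc by blast
    show ?case
    proof (intro exI[of _ d] conjI allI impI d(1))
      fix a b assume "a \<le> x \<and> x \<le> b \<and> b - a < d"
      then have "{a..b} \<subseteq> {x - d..x + d}" by auto
      from mono[OF this] d(2) show "?J a b < \<infinity>" by (rule le_less_trans)
    qed
  qed
qed simp

section \<open>Lifting circle maps to the line\<close>

lemma deriv_periodic:
  fixes g :: "real \<Rightarrow> real"
  assumes per: "\<And>x. g (x + 1) = g x" and "\<And>x. g differentiable (at x)"
  shows "deriv g (x + 1) = deriv g x"
proof -
  have "(g has_real_derivative deriv g (x + 1)) (at (x + 1))"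
    using assms(2) by (simp add: DERIV_deriv_iff_real_differentiable)
  then have "((\<lambda>x. g (x + 1)) has_real_derivative deriv g (x + 1)) (at x)"
    by (simp add: DERIV_shift)
  then show ?thesis by (simp add: per DERIV_imp_deriv)
qed

lemma periodic_frac:
  fixes g :: "real \<Rightarrow> 'b"
  assumes "\<And>x. g (x + 1) = g x"
  shows "g (x + of_int m) = g x" "g (frac x) = g x"
proof -
  interpret periodic_fun_simple' g by unfold_locales (rule assms)
  show "g (x + of_int m) = g x" for m :: int by (rule plus_of_int)
  from this[of "- \<lfloor>x\<rfloor>"] show "g (frac x) = g x" by (simp add: frac_def)
qed

lemma C0_norm_bound:
  assumes per: "\<And>x. g (x + 1) = g x" and cont: "continuous_on UNIV g"
  shows "\<bar>g x\<bar> \<le> C0_norm g"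
proof -
  have "compact (g ` {0..1})" by (intro compact_continuous_image continuous_on_subset[OF cont]) auto
  then obtain B where B: "\<And>y. y \<in> {0..1} \<Longrightarrow> \<bar>g y\<bar> \<le> B"
    using compact_imp_bounded bounded_iff by (metis image_eqI real_norm_def)
  have "\<bar>g (frac x)\<bar> \<le> C0_norm g"
    unfolding C0_norm_def
  proof (rule cSUP_upper)
    show "frac x \<in> circle" by (simp add: circle_def frac_lt_1)
    show "bdd_above ((\<lambda>x. \<bar>g x\<bar>) ` circle)"
      using B by (intro bdd_aboveI[of _ B]) (auto simp: circle_def)
  qed
  then show ?thesis using periodic_frac(2)[of g x, OF per] by simp
qed

lemma frac_in_circle: "frac x \<in> circle"
  by (simp add: circle_def frac_lt_1)

lemma circle_dist_less_imp:
  assumes "circle_dist x y < s"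
  shows "\<exists>m::int. \<bar>x - y + of_int m\<bar> < s"
proof -
  consider "\<bar>x - y\<bar> < s" | "\<bar>x - y + 1\<bar> < s" | "\<bar>x - y - 1\<bar> < s"
    using assms by (auto simp: circle_dist_def min_less_iff_disj)
  then show ?thesis
  proof cases
    case 1 then show ?thesis by (intro exI[of _ 0]) simp
  next
    case 2 then show ?thesis by (intro exI[of _ 1]) simp
  next
    case 3 then show ?thesis by (intro exI[of _ "-1"]) simp
  qed
qed

lemma circle_dist_le:
  assumes "x \<in> circle" "y \<in> circle"
  shows "circle_dist x y \<le> \<bar>x - y + of_int m\<bar>"
proof -
  have xy: "\<bar>x - y\<bar> < 1" using assms by (auto simp: circle_def)
  consider "m = 0" | "m = 1" | "m = -1" | "m \<ge> 2" | "m \<le> -2" by linarith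
  then show ?thesis
  proof cases
    case 4
    then have "2 \<le> (of_int m :: real)" by simp
    then show ?thesis using xy by (auto simp: circle_dist_def min_le_iff_disj)
  next
    case 5
    then have "(of_int m :: real) \<le> -2" by simp
    then show ?thesis using xy by (auto simp: circle_dist_def min_le_iff_disj)
  qed (auto simp: circle_dist_def)
qed

text \<open>
  Passing from the lift \<open>A\<close> to the circle changes \<open>A (y + h) - A y\<close> by an integer, and subtracting the nearest
  integer undoes this as long as the increment is smaller than \<open>1/2\<close>.
\<close>

lemma circle_deriv_lift:
  assumes lift: "\<And>z. g (frac z) = frac (A z)" and A: "(A has_real_derivative D) (at y)"
  shows "circle_deriv g (frac y) = D"
proof -
  have shift: "((\<lambda>h. A (y + h)) has_real_derivative D) (at 0)"
    using A DERIV_shift[of A D 0 y] by (simp add: add.commute)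
  have eq: "(let t = g (frac (frac y + h)) - g (frac y) in t - of_int (round t))
      = (A (y + h) - A y) - of_int (round (A (y + h) - A y))" for h
  proof -
    have "frac (frac y + h) = frac (y + h)"
      using frac_add_of_int_right[of "y + h" "- \<lfloor>y\<rfloor>"] by (simp add: frac_def algebra_simps)
    then have t: "g (frac (frac y + h)) - g (frac y) = (A (y + h) - A y) + of_int (\<lfloor>A y\<rfloor> - \<lfloor>A (y + h)\<rfloor>)"
      by (simp add: lift) (simp add: frac_def)
    have rnd: "round (z + of_int m) = round z + m" for z :: real and m
      unfolding round_def by (metis (no_types, opaque_lifting) add.assoc add.commute floor_add_int)
    then show ?thesis unfolding t Let_def rnd by simp
  qed
  have "isCont (\<lambda>h. A (y + h)) 0" using shift by (rule DERIV_isCont)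
  then have "((\<lambda>h. A (y + h)) \<longlongrightarrow> A y) (nhds 0)"
    by (simp add: isCont_def tendsto_nhds_iff)
  then have "\<forall>\<^sub>F h in nhds 0. dist (A (y + h)) (A y) < 1 / 2" by (rule tendstoD) simp
  then have ev: "\<forall>\<^sub>F h in nhds 0. (let t = g (frac (frac y + h)) - g (frac y) in t - of_int (round t))
      = A (y + h) - A y"
  proof eventually_elim
    case (elim h)
    then have "round (A (y + h) - A y) = 0" by (intro round_unique') (simp add: dist_real_def)
    then show ?case unfolding eq by simp
  qed
  have "circle_deriv g (frac y) = deriv (\<lambda>h. A (y + h) - A y) 0"
    unfolding circle_deriv_def by (rule deriv_cong_ev[OF ev refl])
  also have "\<dots> = D" using shift by (intro DERIV_imp_deriv) (auto intro!: derivative_eq_intros)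
  finally show ?thesis .
qed

lemma noisy_orbit_derivative:
  assumes "\<And>x. (F has_real_derivative F' x) (at x)"
  shows "(noisy_orbit F \<omega> n has_real_derivative (\<Prod>j<n. F' (noisy_orbit F \<omega> j y + \<omega> j))) (at y)"
proof (induction n)
  case 0
  have "noisy_orbit F \<omega> 0 = (\<lambda>x. x)" by (simp add: fun_eq_iff)
  then show ?case by simp
next
  case (Suc n)
  have "((\<lambda>y. F (noisy_orbit F \<omega> n y + \<omega> n)) has_real_derivative
      F' (noisy_orbit F \<omega> n y + \<omega> n) * (\<Prod>j<n. F' (noisy_orbit F \<omega> j y + \<omega> j))) (at y)"
    by (rule DERIV_chain2[OF assms]) (use Suc in \<open>auto intro!: derivative_eq_intros\<close>)
  moreover have "noisy_orbit F \<omega> (Suc n) = (\<lambda>y. F (noisy_orbit F \<omega> n y + \<omega> n))" by (simp add: fun_eq_iff)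
  ultimately show ?case by (simp add: mult.commute)
qed

section \<open>Contracting cycles on the circle\<close>

lemma frac_measurable [measurable]: "(frac :: real \<Rightarrow> real) \<in> borel_measurable borel"
  unfolding frac_def by measurable

lemma sets_circle_borel: "B \<in> sets circle_borel \<longleftrightarrow> B \<in> sets borel \<and> B \<subseteq> circle"
  unfolding circle_borel_def by (subst sets_restrict_space_iff) (auto simp: circle_def)

lemma space_circle_borel [simp]: "space circle_borel = circle"
  by (simp add: circle_borel_def space_restrict_space)

lemma frac_measurable_circle [measurable]: "frac \<in> measurable borel circle_borel"
  unfolding circle_borel_def
  by (rule measurable_restrict_space2) (auto intro: frac_in_circle)

text \<open>
  The cycle lives on the line, and periodicity of \<open>F\<close> is all that is needed to push it to the circle.
\<close>

locale circle_cycle = contracting_cycle_nondegenerate +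
  assumes F_periodic: "F (x + 1) = F x"
begin

abbreviation "circle_F \<equiv> \<lambda>x. frac (F x)"

definition circle_law :: "real measure" where
  "circle_law = distr cycle_law circle_borel frac"

lemma sets_circle_law [simp]: "sets circle_law = sets circle_borel"
  by (simp add: circle_law_def)

lemma space_circle_law [simp]: "space circle_law = circle"
  by (simp add: circle_law_def)

lemma perturbed_map_frac: "perturbed_map circle_F w (frac x) = frac (F (x + w))"
proof -
  have 1: "F (frac (frac x + w)) = F (frac x + w)" by (rule periodic_frac(2)) (rule F_periodic)
  have 2: "frac x + w = x + w + of_int (- \<lfloor>x\<rfloor>)" by (simp add: frac_def)
  have 3: "F (x + w + of_int (- \<lfloor>x\<rfloor>)) = F (x + w)" by (rule periodic_frac(1)) (rule F_periodic)
  show ?thesis unfolding perturbed_map_def 1 unfolding 2 3 ..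
qed

lemma random_comp_frac: "random_comp circle_F \<omega> n (frac x) = frac (orb \<omega> n x)"
  by (induction n) (auto simp: perturbed_map_frac)

lemma stationary_circle_law: "stationary circle_F \<epsilon> circle_law"
  unfolding stationary_def
proof (intro conjI ballI)
  show "prob_space circle_law"
    unfolding circle_law_def by (intro prob_space.prob_space_distr prob_space_cycle_law) measurable
  show "sets circle_law = sets circle_borel" by simp
  fix B assume B: "B \<in> sets circle_borel"
  then have B' [measurable]: "B \<in> sets borel" by (simp add: sets_circle_borel)
  have [measurable]: "(\<lambda>x. frac (F (frac x))) \<in> borel_measurable borel" by measurable
  have meas: "(\<lambda>x. emeasure (noise \<epsilon>) {w \<in> {-\<epsilon>..\<epsilon>}. perturbed_map circle_F w x \<in> B}) \<in> borel_measurable circle_borel"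
    unfolding circle_borel_def perturbed_map_def
    by (rule measurable_restrict_space1) measurable
  have "emeasure circle_law B = emeasure cycle_law {x. frac x \<in> B}"
    unfolding circle_law_def using B by (subst emeasure_distr) (auto simp: vimage_def)
  also have "\<dots> = (\<integral>\<^sup>+ x. emeasure (noise \<epsilon>) {w\<in>{-\<epsilon>..\<epsilon>}. F (x + w) \<in> {x. frac x \<in> B}} \<partial>cycle_law)"
    by (rule cycle_law_stationary) measurable
  also have "\<dots> = (\<integral>\<^sup>+ x. emeasure (noise \<epsilon>) {w \<in> {-\<epsilon>..\<epsilon>}. perturbed_map circle_F w (frac x) \<in> B} \<partial>cycle_law)"
    by (simp add: perturbed_map_frac)
  also have "\<dots> = (\<integral>\<^sup>+ x. emeasure (noise \<epsilon>) {w \<in> {-\<epsilon>..\<epsilon>}. perturbed_map circle_F w x \<in> B} \<partial>circle_law)"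
    unfolding circle_law_def using meas by (subst nn_integral_distr) auto
  finally show "emeasure circle_law B
      = (\<integral>\<^sup>+ x. emeasure (noise \<epsilon>) {w \<in> {-\<epsilon>..\<epsilon>}. perturbed_map circle_F w x \<in> B} \<partial>circle_law)" .
qed

text \<open>
  The image of the intervals on the circle, described by integer translates so that it is visibly
  a Borel set; starting points in it are exactly those for which the exponent is established.
\<close>

definition circle_trap :: "real set" where
  "circle_trap = {x \<in> circle. \<exists>i<N. \<exists>m::int. \<bar>x + of_int m - p i\<bar> \<le> r i}"

lemma AE_circle_trap: "AE x in circle_law. x \<in> circle_trap"
proof -
  define C where "C i m = {x. \<bar>x + of_int m - p i\<bar> \<le> r i}" for i and m :: int
  have eq: "circle_trap = circle \<inter> (\<Union>i\<in>{..<N}. \<Union>m. C i m)"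
    by (auto simp: circle_trap_def C_def)
  have "C i m \<in> sets borel" for i m
    unfolding C_def by (intro borel_closed closed_Collect_le continuous_intros)
  then have "(\<Union>i\<in>{..<N}. \<Union>m. C i m) \<in> sets borel"
    by (intro sets.finite_UN sets.countable_UN'') auto
  then have "circle_trap \<in> sets borel"
    unfolding eq circle_def by (intro sets.Int) simp_all
  moreover have "circle_trap \<subseteq> circle" unfolding eq by (rule Int_lower1)
  ultimately have m: "circle_trap \<in> sets circle_borel" by (simp add: sets_circle_borel)
  have "(AE x in circle_law. x \<in> circle_trap) \<longleftrightarrow> (AE x in cycle_law. frac x \<in> circle_trap)"
    unfolding circle_law_def
  proof (rule AE_distr_iff)
    have "{x \<in> space circle_borel. x \<in> circle_trap} = circle_trap" by (auto simp: circle_trap_def)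
    then show "{x \<in> space circle_borel. x \<in> circle_trap} \<in> sets circle_borel" using m by simp
  qed measurable
  moreover have "AE x in cycle_law. frac x \<in> circle_trap"
    using AE_cycle_law_trap
  proof eventually_elim
    case (elim x)
    then obtain i where i: "i < N" "\<bar>x - p i\<bar> \<le> r i"
      unfolding trap_union_eq by (auto simp: trap_def)
    have "\<exists>m::int. \<bar>frac x + of_int m - p i\<bar> \<le> r i"
      using i(2) by (intro exI[of _ "\<lfloor>x\<rfloor>"]) (simp add: frac_def)
    with i(1) show ?case unfolding circle_trap_def
      by (intro CollectI conjI frac_in_circle exI[of _ i])
  qed
  ultimately show ?thesis by blast
qed

text \<open>
  The law is carried by arcs of radius at most \<open>\<rho>\<close>, so every ball of radius \<open>R - \<rho>\<close> around a point
  of the support meets one of these arcs.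
\<close>

lemma circle_support_near_cycle:
  assumes x: "x \<in> circle_support circle_law" and R: "\<And>i. r i \<le> \<rho>" "\<rho> < R"
  shows "\<exists>i<N. circle_dist x (frac (p i)) < R"
proof -
  define A where "A = {y \<in> circle. circle_dist x y < R - \<rho>}"
  have xc: "x \<in> circle" and pos: "0 < emeasure circle_law A"
    using x R by (auto simp: circle_support_def A_def)
  have "\<exists>y\<in>circle_trap. circle_dist x y < R - \<rho>"
  proof (rule ccontr)
    assume "\<not> ?thesis"
    then have "AE y in circle_law. \<not> circle_dist x y < R - \<rho>"
      using AE_circle_trap by (auto elim: eventually_mono)
    then have "emeasure circle_law {y \<in> space circle_law. circle_dist x y < R - \<rho>} = 0"
      by (rule emeasure_eq_0_AE)
    with pos show False by (simp add: A_def)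
  qed
  then obtain y i m where y: "circle_dist x y < R - \<rho>" "i < N" "\<bar>y + of_int m - p i\<bar> \<le> r i"
    by (auto simp: circle_trap_def)
  obtain m' :: int where m': "\<bar>x - y + of_int m'\<bar> < R - \<rho>"
    using circle_dist_less_imp[OF y(1)] by blast
  have "circle_dist x (frac (p i)) \<le> \<bar>x - frac (p i) + of_int (m' + m - \<lfloor>p i\<rfloor>)\<bar>"
    by (rule circle_dist_le[OF xc frac_in_circle])
  also have "x - frac (p i) + of_int (m' + m - \<lfloor>p i\<rfloor>) = (x - y + of_int m') + (y + of_int m - p i)"
    by (simp add: frac_def)
  also have "\<bar>\<dots>\<bar> < R" using m' y(3) R(1)[of i] by linarith
  finally show ?thesis using y(2) by blast
qed

lemma negative_lyapunov_exponent: "\<exists>l<0. has_lyapunov_exponent circle_F \<epsilon> circle_law l"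
proof -
  obtain l where l: "l < 0" "\<And>y. y \<in> trap_union \<Longrightarrow> AE \<omega> in noise_seq \<epsilon>.
      (\<forall>j. F' (orb \<omega> j y + \<omega> j) \<noteq> 0) \<and>
      (\<lambda>n. (\<Sum>j<n. log_slope (orb \<omega> j y + \<omega> j)) / real n) \<longlonglongrightarrow> l"
    using negative_exponent_on_line by blast
  have "AE x in circle_law. AE \<omega> in noise_seq \<epsilon>.
        (\<lambda>n. log_abs (circle_deriv (random_comp circle_F \<omega> n) x) / ereal (real n)) \<longlonglongrightarrow> ereal l"
    using AE_circle_trap
  proof eventually_elim
    case (elim x)
    then obtain i m where im: "x \<in> circle" "\<bar>x + of_int m - p i\<bar> \<le> r i"
      by (auto simp: circle_trap_def)
    define y where "y = x + of_int m"
    have x: "x = frac y" using im(1) by (simp add: y_def circle_def frac_eq)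
    have y: "y \<in> trap_union" using im(2) by (auto simp: y_def trap_union_def trap_def)
    show ?case using l(2)[OF y]
    proof eventually_elim
      case (elim \<omega>)
      define S where "S n = (\<Sum>j<n. log_slope (orb \<omega> j y + \<omega> j))" for n
      have D: "log_abs (circle_deriv (random_comp circle_F \<omega> n) x) = ereal (S n)" for n
      proof -
        have "circle_deriv (random_comp circle_F \<omega> n) x = (\<Prod>j<n. F' (orb \<omega> j y + \<omega> j))"
          unfolding x by (rule circle_deriv_lift[OF random_comp_frac noisy_orbit_derivative[OF F_deriv]])
        moreover have "(\<Prod>j<n. F' (orb \<omega> j y + \<omega> j)) \<noteq> 0" using elim by simp
        moreover have "ln \<bar>\<Prod>j<n. F' (orb \<omega> j y + \<omega> j)\<bar> = S n"
          unfolding S_def abs_prod using elim by (intro ln_prod) auto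
        ultimately show ?thesis by (simp add: log_abs_def)
      qed
      have "(\<lambda>n. ereal (S n / real n)) \<longlonglongrightarrow> ereal l"
        using elim by (simp add: S_def)
      moreover have "\<forall>\<^sub>F n in sequentially. ereal (S n / real n)
          = log_abs (circle_deriv (random_comp circle_F \<omega> n) x) / ereal (real n)"
        using eventually_gt_at_top[of 0] by eventually_elim (simp add: D)
      ultimately show ?case by (rule Lim_transform_eventually)
    qed
  qed
  then show ?thesis using l(1) by (auto simp: has_lyapunov_exponent_def)
qed

end

section \<open>Periodic critical points\<close>

text \<open>
  A length count: each arc is contained in three real intervals of length \<open>2 * R\<close>.
\<close>

lemma circle_not_covered:
  fixes q :: "nat \<Rightarrow> real"
  assumes "0 \<le> R" "real K * (6 * R) < 1"
  shows "\<exists>x\<in>circle. \<forall>i<K. R \<le> circle_dist x (q i)"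
proof (rule ccontr)
  assume neg: "\<not> ?thesis"
  let ?A = "\<lambda>(i, e). {q i + e - R..q i + e + R}"
  let ?I = "{..<K} \<times> {-1, 0, 1 :: real}"
  have "circle \<subseteq> (\<Union>z\<in>?I. ?A z)"
  proof
    fix x assume "x \<in> circle"
    then obtain i where i: "i < K" "circle_dist x (q i) < R" using neg by force
    then have "\<bar>x - q i\<bar> < R \<or> \<bar>x - q i + 1\<bar> < R \<or> \<bar>x - q i - 1\<bar> < R"
      by (auto simp: circle_dist_def min_less_iff_disj)
    then have "\<exists>e\<in>{-1, 0, 1}. x \<in> ?A (i, e)" by auto
    then show "x \<in> (\<Union>z\<in>?I. ?A z)" using i(1) by blast
  qed
  then have "emeasure lborel circle \<le> emeasure lborel (\<Union>z\<in>?I. ?A z)"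
    by (intro emeasure_mono) (auto intro!: sets.finite_UN)
  also have "\<dots> \<le> (\<Sum>z\<in>?I. emeasure lborel (?A z))"
    by (rule emeasure_subadditive_finite) auto
  also have "\<dots> = (\<Sum>z\<in>?I. ennreal (2 * R))"
    using assms(1) by (intro sum.cong) auto
  also have "\<dots> = ennreal (real K * (6 * R))"
    using assms(1) by (simp add: card_cartesian_product ennreal_of_nat_eq_real_of_nat flip: ennreal_mult)
  also have "\<dots> < ennreal 1" using assms(2) by (intro ennreal_lessI) auto
  finally show False by (simp add: circle_def)
qed

text \<open>
  The cycle starts at the first iterate of \<open>c\<close>, because \<open>F ^^ (k + 1)\<close> returns \<open>c\<close> to itself only up to an
  integer, which \<open>F\<close> then forgets.  Hence the critical point is the last one of the cycle, the radii
  grow by \<open>L\<close> before it, and drop from \<open>L ^ (-(k+1))\<close> to \<open>L ^ (-(2k+1))\<close> after it.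
\<close>

lemma critical_cycle_contracts:
  fixes \<psi> :: "real \<Rightarrow> real" and L a \<epsilon> :: real and k :: nat
  assumes C2: "circle_C2 \<psi>"
    and fin: "finite (critical_set \<psi>)"
    and nondeg: "\<forall>c\<in>critical_set \<psi>. deriv (deriv \<psi>) c \<noteq> 0"
    and n1: "C0_norm (deriv \<psi>) \<le> 1 / 10"
    and n2: "C0_norm (deriv (deriv \<psi>)) \<le> 1 / 10"
    and L: "1 \<le> L" and c: "c \<in> critical_set \<psi>"
    and cyc: "frac (((\<lambda>y. L * \<psi> y + a) ^^ (k + 1)) c) = c"
    and eps: "0 < \<epsilon>" "\<epsilon> \<le> 1 / 49 * (1 / L ^ (2 * k + 1))"
  shows "circle_cycle (\<lambda>y. L * \<psi> y + a) (\<lambda>y. L * deriv \<psi> y)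
    (\<lambda>j. ((\<lambda>y. L * \<psi> y + a) ^^ Suc j) c) (\<lambda>j. 1 / 49 * (1 / L ^ (2 * k + 1 - j mod (k + 1))))
    (k + 1) \<epsilon> (1 / 10)"
proof -
  define F where "F y = L * \<psi> y + a" for y
  define P where "P j = (F ^^ Suc j) c" for j
  define r where "r j = 1 / 49 * (1 / L ^ (2 * k + 1 - j mod (k + 1)))" for j
  have per: "\<psi> (x + 1) = \<psi> x" and d1: "\<psi> differentiable (at x)" and d2: "deriv \<psi> differentiable (at x)" for x
    using C2 by (auto simp: circle_C2_def)
  have c2: "continuous_on UNIV (deriv (deriv \<psi>))" using C2 by (simp add: circle_C2_def)
  have D1: "(\<psi> has_real_derivative deriv \<psi> x) (at x)" for x
    using d1 by (simp add: DERIV_deriv_iff_real_differentiable)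
  have D2: "(deriv \<psi> has_real_derivative deriv (deriv \<psi>) x) (at x)" for x
    using d2 by (simp add: DERIV_deriv_iff_real_differentiable)
  have c1: "continuous_on UNIV (deriv \<psi>)"
    using D2 by (auto intro: continuous_at_imp_continuous_on DERIV_isCont)
  have per1: "deriv \<psi> (x + 1) = deriv \<psi> x" for x by (rule deriv_periodic[OF per d1])
  have per2: "deriv (deriv \<psi>) (x + 1) = deriv (deriv \<psi>) x" for x by (rule deriv_periodic[OF per1 d2])
  have b1: "\<bar>deriv \<psi> x\<bar> \<le> 1 / 10" for x using C0_norm_bound[of "deriv \<psi>" x, OF per1 c1] n1 by simp
  have b2: "\<bar>deriv (deriv \<psi>) x\<bar> \<le> 1 / 10" for x
    using C0_norm_bound[of "deriv (deriv \<psi>)" x, OF per2 c2] n2 by simp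
  have crit_frac: "frac y \<in> critical_set \<psi>" if "deriv \<psi> y = 0" for y
    using that periodic_frac(2)[of "deriv \<psi>" y, OF per1] by (simp add: critical_set_def frac_in_circle)
  have F_per: "F (x + 1) = F x" for x by (simp add: F_def per)
  obtain m :: int where m: "(F ^^ (k + 1)) c = c + of_int m"
  proof
    have "frac ((F ^^ (k + 1)) c) = c" using cyc by (simp add: F_def[abs_def])
    then show "(F ^^ (k + 1)) c = c + of_int \<lfloor>(F ^^ (k + 1)) c\<rfloor>"
      unfolding frac_def by linarith
  qed
  have P_per: "P (i + (k + 1)) = P i" for i
  proof -
    have "P (i + (k + 1)) = (F ^^ Suc i) ((F ^^ (k + 1)) c)"
      unfolding P_def by (metis add_Suc comp_apply funpow_add)
    also have "\<dots> = (F ^^ i) (F (c + of_int m))" unfolding m by (simp add: funpow_swap1)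
    also have "F (c + of_int m) = F c" by (rule periodic_frac(1)) (rule F_per)
    finally show ?thesis unfolding P_def by (simp add: funpow_swap1)
  qed
  have P_mod: "P i = P (i mod (k + 1))" for i
  proof -
    have "P (j + n * (k + 1)) = P j" for j n
    proof (induction n)
      case (Suc n)
      then show ?case using P_per[of "j + n * (k + 1)"] by (simp add: algebra_simps)
    qed simp
    from this[of "i mod (k + 1)" "i div (k + 1)"] show ?thesis unfolding mod_div_mult_eq .
  qed
  have Lpow: "L ^ i \<le> L ^ j" if "i \<le> j" for i j using that L by (rule power_increasing)
  have r_ge: "\<epsilon> \<le> r i" for i
  proof -
    have "1 / L ^ (2 * k + 1) \<le> 1 / L ^ (2 * k + 1 - i mod (k + 1))"
      using L by (intro divide_left_mono Lpow) auto
    then show ?thesis using eps(2) by (simp add: r_def)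
  qed
  have r_pos: "0 < r i" for i using L by (simp add: r_def)
  have contr: "\<bar>L * deriv \<psi> y\<bar> * r i \<le> 1 / 10 * r (Suc i)" if y: "\<bar>y - P i\<bar> \<le> r i + \<epsilon>" for y i
  proof (cases "i mod (k + 1) = k")
    case False
    define j where "j = i mod (k + 1)"
    have "j < k + 1" unfolding j_def by (rule mod_less_divisor) simp
    then have j: "j < k" using False unfolding j_def by linarith
    have "Suc i mod (k + 1) = Suc j" using j by (simp add: j_def mod_Suc)
    then have "2 * k + 1 - Suc i mod (k + 1) = 2 * k - j" by simp
    then have "r (Suc i) = 1 / 49 * (1 / L ^ (2 * k - j))" by (simp only: r_def)
    moreover have "2 * k + 1 - i mod (k + 1) = Suc (2 * k - j)" using j unfolding j_def by linarith
    then have "r i = 1 / 49 * (1 / L ^ Suc (2 * k - j))" by (simp only: r_def)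
    ultimately have "r (Suc i) = L * r i" using L by simp
    moreover have "\<bar>L * deriv \<psi> y\<bar> * r i \<le> (L * (1 / 10)) * r i"
      using L b1[of y] r_pos[of i] by (intro mult_right_mono) (auto simp: abs_mult intro!: mult_left_mono)
    ultimately show ?thesis by simp
  next
    case True
    have "P i = P k" using P_mod[of i] unfolding True .
    then have Pi: "P i = c + of_int m" using m by (simp add: P_def)
    have "deriv \<psi> (c + of_int m) = deriv \<psi> c" by (rule periodic_frac(1)) (rule per1)
    also have "\<dots> = 0" using c by (simp add: critical_set_def)
    finally have 0: "deriv \<psi> (P i) = 0" by (simp add: Pi)
    have "norm (deriv \<psi> y - deriv \<psi> (P i)) \<le> 1 / 10 * norm (y - P i)"
      by (rule field_differentiable_bound[of UNIV "deriv \<psi>" "deriv (deriv \<psi>)"])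
        (use D2 b2 in auto)
    then have d: "\<bar>deriv \<psi> y\<bar> \<le> 1 / 10 * (2 * r i)" using 0 y r_ge[of i] by simp
    have "2 * k + 1 - i mod (k + 1) = k + 1" unfolding True by simp
    then have ri: "r i = 1 / 49 * (1 / L ^ (k + 1))" by (simp only: r_def)
    have "2 * k + 1 - Suc i mod (k + 1) = 2 * k + 1" using True by (simp add: mod_Suc)
    then have rS: "r (Suc i) = 1 / 49 * (1 / L ^ (2 * k + 1))" by (simp only: r_def)
    have pow: "L * (1 / L ^ (k + 1)) * (1 / L ^ (k + 1)) = 1 / L ^ (2 * k + 1)"
    proof -
      have "L * L ^ (2 * k + 1) = L ^ (k + 1) * L ^ (k + 1)"
        by (simp add: mult_2 flip: power_add power_Suc)
      then show ?thesis using L by (simp add: field_simps)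
    qed
    have "\<bar>L * deriv \<psi> y\<bar> * r i \<le> (L * (1 / 10 * (2 * r i))) * r i"
      using L d r_pos[of i] by (intro mult_right_mono) (auto simp: abs_mult intro!: mult_left_mono)
    also have "\<dots> = 1 / 10 * (2 / 49) * (1 / 49 * (L * (1 / L ^ (k + 1)) * (1 / L ^ (k + 1))))"
      unfolding ri by (simp add: mult_ac)
    also have "\<dots> = 1 / 10 * (2 / 49) * r (Suc i)" unfolding pow rS ..
    also have "\<dots> \<le> 1 / 10 * r (Suc i)" using r_pos[of "Suc i"] by simp
    finally show ?thesis .
  qed
  have zeros: "{y. L * deriv \<psi> y = 0} \<subseteq> (\<Union>c\<in>critical_set \<psi>. range (\<lambda>m::int. c + of_int m))"
  proof
    fix y assume "y \<in> {y. L * deriv \<psi> y = 0}"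
    then have "frac y \<in> critical_set \<psi>" using L by (intro crit_frac) auto
    moreover have "y = frac y + of_int \<lfloor>y\<rfloor>" by (simp add: frac_def)
    ultimately show "y \<in> (\<Union>c\<in>critical_set \<psi>. range (\<lambda>m::int. c + of_int m))" by blast
  qed
  have "circle_cycle F (\<lambda>y. L * deriv \<psi> y) P r (k + 1) \<epsilon> (1 / 10)"
  proof unfold_locales
    show "(F has_real_derivative L * deriv \<psi> x) (at x)" for x
      unfolding F_def by (auto intro!: derivative_eq_intros D1)
    show "continuous_on UNIV (\<lambda>y. L * deriv \<psi> y)" by (intro continuous_intros c1)
    show "countable {y. L * deriv \<psi> y = 0}"
      by (rule countable_subset[OF zeros]) (use fin in \<open>auto intro: countable_finite\<close>)
    show "(\<integral>\<^sup>+ y. ennreal (\<bar>L * deriv \<psi> y\<bar> powr (- 1 / 2)) * indicator {a..b} y \<partial>lborel) < \<infinity>" for a b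
    proof (rule inverse_sqrt_integrable_simple_zeros)
      show "continuous_on UNIV (\<lambda>y. L * deriv \<psi> y)" by (intro continuous_intros c1)
      fix z assume "L * deriv \<psi> z = 0"
      then have "frac z \<in> critical_set \<psi>" using L by (intro crit_frac) auto
      then have "deriv (deriv \<psi>) z \<noteq> 0"
        using nondeg periodic_frac(2)[of "deriv (deriv \<psi>)" z, OF per2] by auto
      moreover have "((\<lambda>y. L * deriv \<psi> y) has_real_derivative L * deriv (deriv \<psi>) z) (at z)"
        by (auto intro!: derivative_eq_intros D2)
      ultimately show "\<exists>m. m \<noteq> 0 \<and> ((\<lambda>y. L * deriv \<psi> y) has_real_derivative m) (at z)"
        using L by (intro exI[of _ "L * deriv (deriv \<psi>) z"]) auto
    qed
    show "P (i + (k + 1)) = P i" for i by (rule P_per)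
    show "F (P i) = P (Suc i)" for i by (simp add: P_def)
    show "r (i + (k + 1)) = r i" for i unfolding r_def by (simp only: mod_add_self2)
    show "\<epsilon> \<le> r i" for i by (rule r_ge)
    show "\<bar>L * deriv \<psi> y\<bar> * r i \<le> 1 / 10 * r (Suc i)" if "\<bar>y - P i\<bar> \<le> r i + \<epsilon>" for y i
      by (rule contr[OF that])
  qed (use eps F_per in simp_all)
  then show ?thesis unfolding F_def[abs_def] P_def[abs_def] r_def[abs_def] .
qed

theorem proposition2:
  fixes \<psi> :: "real \<Rightarrow> real"
  assumes "circle_C2 \<psi>"
    and "finite (critical_set \<psi>)"
    and "\<forall>c\<in>critical_set \<psi>. deriv (deriv \<psi>) c \<noteq> 0"
    and "C0_norm (deriv \<psi>) \<le> 1 / 10"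
    and "C0_norm (deriv (deriv \<psi>)) \<le> 1 / 10"
  shows "\<exists>L0>0. \<forall>L\<ge>L0. \<forall>k::nat. \<forall>a\<in>{0..<1}. \<forall>c\<in>critical_set \<psi>.
           (circle_map \<psi> L a ^^ (k + 1)) c = c \<longrightarrow>
           (\<forall>\<epsilon>. 0 < \<epsilon> \<and> \<epsilon> \<le> 1 / 49 * (1 / L ^ (2 * k + 1)) \<longrightarrow>
             (\<exists>\<mu>. stationary (circle_map \<psi> L a) \<epsilon> \<mu> \<and>
                  circle_support \<mu> \<subseteq>
                    {x \<in> circle. \<exists>i\<le>k. circle_dist x ((circle_map \<psi> L a ^^ i) c)
                                         < 1 / 7 * (1 / L ^ (k + 1))} \<and>
                  circle_support \<mu> \<subset> circle \<and>
                  (\<exists>l<0. has_lyapunov_exponent (circle_map \<psi> L a) \<epsilon> \<mu> l)))"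
proof (rule exI[of _ 2], intro conjI allI ballI impI)
  fix L a c \<epsilon> :: real and k :: nat
  assume L: "2 \<le> L" and c: "c \<in> critical_set \<psi>"
    and cyc: "(circle_map \<psi> L a ^^ (k + 1)) c = c"
    and eps: "0 < \<epsilon> \<and> \<epsilon> \<le> 1 / 49 * (1 / L ^ (2 * k + 1))"
  define F where "F y = L * \<psi> y + a" for y
  define R where "R = 1 / 7 * (1 / L ^ (k + 1))"
  have F_per: "F (x + 1) = F x" for x
    using assms(1) by (simp add: F_def circle_C2_def)
  have f_eq: "circle_map \<psi> L a = (\<lambda>x. frac (F x))"
    by (simp add: fun_eq_iff circle_map_def F_def)
  have c_circle: "c \<in> circle" using c by (simp add: critical_set_def)
  have orbit: "(circle_map \<psi> L a ^^ i) c = frac ((F ^^ i) c)" for i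
  proof (induction i)
    case 0
    then show ?case using c_circle by (simp add: circle_def frac_eq)
  next
    case (Suc i)
    then show ?case using periodic_frac(2)[of F, OF F_per] by (simp add: f_eq)
  qed
  interpret circle_cycle F "\<lambda>y. L * deriv \<psi> y" "\<lambda>j. (F ^^ Suc j) c"
    "\<lambda>j. 1 / 49 * (1 / L ^ (2 * k + 1 - j mod (k + 1)))" "k + 1" \<epsilon> "1 / 10"
    unfolding F_def[abs_def]
    by (rule critical_cycle_contracts[OF assms]) (use L c eps cyc orbit[of "k + 1"] in \<open>auto simp: F_def[abs_def]\<close>)
  have near: "\<exists>i\<le>k. circle_dist x ((circle_map \<psi> L a ^^ i) c) < R"
    if x: "x \<in> circle_support circle_law" for x
  proof -
    have "\<exists>i<k + 1. circle_dist x (frac ((F ^^ Suc i) c)) < R"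
    proof (rule circle_support_near_cycle[OF x])
      show "1 / 49 * (1 / L ^ (2 * k + 1 - i mod (k + 1))) \<le> 1 / 49 * (1 / L ^ (k + 1))" for i
      proof -
        have "i mod (k + 1) < k + 1" by (rule mod_less_divisor) simp
        then have "k + 1 \<le> 2 * k + 1 - i mod (k + 1)" by linarith
        then have "L ^ (k + 1) \<le> L ^ (2 * k + 1 - i mod (k + 1))"
          by (rule power_increasing) (use L in simp)
        then show ?thesis using L by (intro mult_left_mono divide_left_mono) auto
      qed
      show "1 / 49 * (1 / L ^ (k + 1)) < R"
        unfolding R_def by (rule mult_strict_right_mono) (use L in simp_all)
    qed
    then obtain i where i: "i \<le> k" "circle_dist x ((circle_map \<psi> L a ^^ Suc i) c) < R"
      unfolding orbit[symmetric] by (auto simp: less_Suc_eq_le)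
    show ?thesis
    proof (cases "i = k")
      case True
      then show ?thesis using i cyc by (intro exI[of _ 0]) simp
    next
      case False
      then show ?thesis using i by (intro exI[of _ "Suc i"]) simp
    qed
  qed
  have "\<exists>x\<in>circle. \<forall>i<k + 1. R \<le> circle_dist x ((circle_map \<psi> L a ^^ i) c)"
  proof (rule circle_not_covered)
    \<comment> \<open>The total length is \<open>6 / 7 * (k + 1) / L ^ (k + 1)\<close>; this is where \<open>L \<ge> 2\<close> matters.\<close>
    have "real (k + 1) < 2 ^ (k + 1)" by (rule of_nat_less_two_power)
    also have "\<dots> \<le> L ^ (k + 1)" using L by (intro power_mono) auto
    finally show "real (k + 1) * (6 * R) < 1" using L by (simp add: R_def divide_less_eq)
    show "0 \<le> R" using L by (simp add: R_def)
  qed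
  then obtain x where x: "x \<in> circle" "\<forall>i\<le>k. \<not> circle_dist x ((circle_map \<psi> L a ^^ i) c) < R"
    by (auto simp: less_Suc_eq_le not_less)
  have sub: "circle_support circle_law \<subseteq> circle" by (auto simp: circle_support_def)
  show "\<exists>\<mu>. stationary (circle_map \<psi> L a) \<epsilon> \<mu> \<and>
      circle_support \<mu> \<subseteq> {x \<in> circle. \<exists>i\<le>k. circle_dist x ((circle_map \<psi> L a ^^ i) c) < 1 / 7 * (1 / L ^ (k + 1))} \<and>
      circle_support \<mu> \<subset> circle \<and>
      (\<exists>l<0. has_lyapunov_exponent (circle_map \<psi> L a) \<epsilon> \<mu> l)"
  proof (intro exI[of _ circle_law] conjI)
    show "stationary (circle_map \<psi> L a) \<epsilon> circle_law"
      unfolding f_eq by (rule stationary_circle_law)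
    show "circle_support circle_law
        \<subseteq> {x \<in> circle. \<exists>i\<le>k. circle_dist x ((circle_map \<psi> L a ^^ i) c) < 1 / 7 * (1 / L ^ (k + 1))}"
      using near sub unfolding R_def by blast
    show "circle_support circle_law \<subset> circle"
      using near x sub by blast
    show "\<exists>l<0. has_lyapunov_exponent (circle_map \<psi> L a) \<epsilon> circle_law l"
      unfolding f_eq by (rule negative_lyapunov_exponent)
  qed
qed simp

end
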